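(* Let $P(x)$ be an even-degree polynomial with real coefficients. Then the following statements are equivalent: (i) $P(x)$ is complete modulo all large enough primes (that is, there is $p_0$ such that $P(x)$ is complete modulo every prime $p\geq p_0$). (ii) $P(x)$ has an irrational coefficient other than the constant term. (iii) The sequence $(\lfloor P(k)\rfloor)_{k\geq 1}$ is u.d. in $\mathbb{Z}$. (iv) $P(x)$ is complete modulo all integers $m\geq 2$.
   Context: A polynomial $P(x)\in\mathbb{R}[x]$ is complete modulo an integer $m\geq 2$ if for every integer $n$ the congruence $\lfloor P(x)\rfloor\equiv n \pmod m$ has a solution $x\in\mathbb{Z}$. An integer sequence $(a_k)_{k\geq 1}$ is u.d. (uniformly distributed) mod an integer $m\geq 2$ if for every integer $i$, $\lim_{N\to\infty}\frac{1}{N}\#\{k\in\{1,\ldots,N\}: a_k\equiv i \pmod m\}=\frac{1}{m}$. It is u.d. in $\mathbb{Z}$ if it is u.d. mod $m$ for all integers $m\geq 2$. Here $\lfloor r\rfloor$ denotes the greatest integer not exceeding $r$. *)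

theory Defs
  imports
    Complex_Main
    "HOL-Computational_Algebra.Computational_Algebra"
    "HOL-Number_Theory.Cong"
begin

definition complete_mod :: "real poly \<Rightarrow> int \<Rightarrow> bool" where
  "complete_mod P m \<longleftrightarrow> (\<forall>n::int. \<exists>x::int. [\<lfloor>poly P (of_int x)\<rfloor> = n] (mod m))"

text \<open>Sequences are indexed from 1; the value at index 0 is irrelevant.\<close>

definition ud_mod :: "(nat \<Rightarrow> int) \<Rightarrow> int \<Rightarrow> bool" where
  "ud_mod a m \<longleftrightarrow>
     (\<forall>i::int. (\<lambda>N. real (card {k \<in> {1..N}. [a k = i] (mod m)}) / real N)
        \<longlonglongrightarrow> 1 / real_of_int m)"

definition ud_in_Z :: "(nat \<Rightarrow> int) \<Rightarrow> bool" where
  "ud_in_Z a \<longleftrightarrow> (\<forall>m\<ge>2. ud_mod a m)"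

end

theory Submission
  imports
    Defs
    "HOL-Analysis.Analysis"
    "HOL-Library.Real_Mod"
    "HOL-Number_Theory.Residues"
begin

text \<open>
  The implications (ii) \<Rightarrow> (iii) \<Rightarrow> (iv) \<Rightarrow> (i) \<Rightarrow> (ii) are proved. The two in the
  middle are immediate: equidistribution modulo \<open>m\<close> makes every residue class occur, and primes are
  moduli.

  (ii) \<Rightarrow> (iii) is Weyl's theorem. The integer \<open>\<lfloor>P k\<rfloor>\<close> is congruent to \<open>i\<close> modulo \<open>m\<close> exactly
  if \<open>P k / m\<close> lies, modulo 1, in the interval \<open>[i/m, (i+1)/m)\<close>. The exponential sums of
  \<open>P / m\<close> are small: van der Corput's inequality trades a polynomial for its differences, and this
  lowers by one the largest index of an irrational coefficient, until that index is 1; then shifting by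
  a common denominator of the other coefficients multiplies the exponential by a constant different
  from 1 (\<open>mean_cis_poly_tendsto_0\<close>). From exponential sums to intervals no integration is
  needed: by Stone-Weierstrass, the limiting average of a continuous function on the circle is not
  changed by a rotation of the function, so it may be replaced by an average over a finite group of
  rotations, which is bounded by a plain count (\<open>upper_density_arc\<close>). This bounds each of the
  \<open>m\<close> densities from above by \<open>1/m\<close>, and since they add up to 1 they are all equal to \<open>1/m\<close>.

  (i) \<Rightarrow> (ii). If all coefficients but the constant one are rational with common denominator
  \<open>d\<close>, there is an integer polynomial \<open>R\<close> with \<open>\<lfloor>P x\<rfloor> = t + p u\<close> only if
  \<open>R x - d t - r\<close> is divisible by \<open>p\<close> for some \<open>0 \<le> r < d\<close>. As \<open>P\<close> has even
  degree it is bounded on one side, so \<open>t\<close> can be fixed such that none of the polynomials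
  \<open>R - d t - r\<close> has a real root. It remains to see that an integer polynomial \<open>F\<close> without real
  roots, here the product of these polynomials, has no root modulo \<open>p\<close> for infinitely many primes \<open>p\<close>
  (\<open>ex_prime_without_root\<close>). This would follow from Chebotarev's theorem applied to complex
  conjugation, but there is an elementary argument. Let \<open>\<theta>\<close> be a real algebraic number such that
  \<open>\<rat>(\<theta>)\<close> contains the real and imaginary parts of all roots of \<open>F\<close> (primitive element
  theorem), and let \<open>g\<close> be its minimal polynomial. As \<open>g\<close> changes its sign at \<open>\<theta>\<close>, its
  homogenisation takes negative values that are close to 1 in the \<open>q\<close>-adic sense for any prescribed
  primes \<open>q\<close>, up to a fixed factor; such a value yields a large prime \<open>p \<equiv> 3 (mod 4)\<close> modulo
  which \<open>g\<close> has a root \<open>b\<close>. Reducing the factorisation of \<open>F\<^sup>2\<close> into the factors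
  \<open>(x - Re z)\<^sup>2 + (Im z)\<^sup>2\<close> along \<open>\<theta> \<mapsto> b\<close> shows that a root of \<open>F\<close> modulo \<open>p\<close>
  gives a sum of two squares that is divisible by \<open>p\<close>. As \<open>p \<equiv> 3 (mod 4)\<close>, it divides the
  image of some imaginary part, which is impossible for large \<open>p\<close> because the imaginary parts are nonzero.
\<close>

(* The polynomial constants of these names are meant throughout. *)
hide_const (open) Module.smult up_ring.coeff up_ring.monom Coset.order

section \<open>Means of bounded sequences and van der Corput's inequality\<close>

definition mean :: "(nat \<Rightarrow> complex) \<Rightarrow> nat \<Rightarrow> complex" where
  "mean u N = (\<Sum>k<N. u k) / of_nat N"

text \<open>
  Shifting by one changes only the two boundary terms.
\<close>
lemma norm_sum_shift_diff_le:
  fixes u :: "nat \<Rightarrow> complex"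
  assumes "\<And>k. norm (u k) \<le> 1"
  shows "norm ((\<Sum>k<N. u (k + h)) - (\<Sum>k<N. u k)) \<le> 2 * real h"
proof (induction h)
  case (Suc h)
  have "(\<Sum>k<N. u (k + Suc h)) - (\<Sum>k<N. u k) =
      ((\<Sum>k<N. u (k + h)) - (\<Sum>k<N. u k)) + (\<Sum>k<N. u (Suc k + h) - u (k + h))"
    by (simp add: sum_subtractf)
  also have "(\<Sum>k<N. u (Suc k + h) - u (k + h)) = u (N + h) - u h"
    using sum_lessThan_telescope[of "\<lambda>k. u (k + h)" N] by simp
  finally have "norm ((\<Sum>k<N. u (k + Suc h)) - (\<Sum>k<N. u k)) \<le>
      norm ((\<Sum>k<N. u (k + h)) - (\<Sum>k<N. u k)) + norm (u (N + h) - u h)"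
    using norm_triangle_ineq by metis
  moreover have "norm (u (N + h) - u h) \<le> norm (u (N + h)) + norm (u h)"
    by (rule norm_triangle_ineq4)
  ultimately show ?case using Suc.IH assms[of "N + h"] assms[of h] by simp
qed simp

lemma mean_tendsto_0_if_bounded_sums:
  assumes "\<And>N. norm (\<Sum>k<N. u k) \<le> B"
  shows "mean u \<longlonglongrightarrow> 0"
proof (rule Lim_null_comparison)
  show "\<forall>\<^sub>F N in sequentially. norm (mean u N) \<le> B / real N"
    using assms by (intro always_eventually allI) (simp add: mean_def norm_divide divide_right_mono)
  show "(\<lambda>N. B / real N) \<longlonglongrightarrow> 0"
    by real_asymp
qed

lemma mean_shift_tendsto_0:
  assumes "\<And>k. norm (u k) \<le> 1" "mean u \<longlonglongrightarrow> 0"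
  shows "mean (\<lambda>k. u (k + h)) \<longlonglongrightarrow> 0"
proof -
  have "mean (\<lambda>k. u (k + h) - u k) \<longlonglongrightarrow> 0"
    by (rule mean_tendsto_0_if_bounded_sums[where B = "2 * real h"])
       (use norm_sum_shift_diff_le[of u] assms in \<open>simp add: sum_subtractf\<close>)
  moreover have "mean (\<lambda>k. u (k + h)) = (\<lambda>N. mean (\<lambda>k. u (k + h) - u k) N + mean u N)"
    by (simp add: mean_def fun_eq_iff sum_subtractf diff_divide_distrib)
  ultimately show ?thesis
    using tendsto_add[OF _ assms(2), of _ 0] by simp
qed

text \<open>
  If shifting the sequence multiplies it by \<open>w\<close>, the partial sums satisfy \<open>w S = S + O(1)\<close>, so
  they are bounded, exactly as for a geometric series.
\<close>
lemma mean_tendsto_0_if_quasiperiodic: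
  assumes "\<And>k. norm (u k) \<le> 1" "\<And>k. u (k + q) = w * u k" "w \<noteq> 1"
  shows "mean u \<longlonglongrightarrow> 0"
proof (rule mean_tendsto_0_if_bounded_sums)
  fix N
  have "norm (w - 1) * norm (\<Sum>k<N. u k) = norm ((\<Sum>k<N. u (k + q)) - (\<Sum>k<N. u k))"
    by (simp add: assms(2) sum_distrib_left [symmetric] norm_mult [symmetric] algebra_simps)
  also have "\<dots> \<le> 2 * real q"
    by (rule norm_sum_shift_diff_le[OF assms(1)])
  finally show "norm (\<Sum>k<N. u k) \<le> 2 * real q / norm (w - 1)"
    using assms(3) by (simp add: field_simps)
qed

text \<open>
  Up to an error at the two ends, the sum of \<open>u\<close> is the average over \<open>h < H\<close> of its shifts by
  \<open>h\<close>. Exchanging the sums and applying Cauchy-Schwarz to the outer one brings in only the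
  correlations of \<open>u\<close> with its own shifts.
\<close>
lemma van_der_corput_inequality:
  fixes u :: "nat \<Rightarrow> complex"
  assumes "\<And>k. norm (u k) \<le> 1"
  shows "real H * norm (mean u N)
    \<le> sqrt (norm (\<Sum>h<H. \<Sum>h'<H. mean (\<lambda>k. u (k + h) * cnj (u (k + h'))) N)) + 2 * (real H)\<^sup>2 / real N"
proof (cases "N = 0")
  case False
  define A where "A = (\<Sum>k<N. \<Sum>h<H. u (k + h))"
  have sum_eq: "(\<Sum>k<N. v k) = of_nat N * mean v N" for v
    using False by (simp add: mean_def)
  have "norm (of_nat H * (\<Sum>k<N. u k) - A) = norm (\<Sum>h<H. (\<Sum>k<N. u (k + h)) - (\<Sum>k<N. u k))"
    unfolding A_def by (subst sum.swap) (subst norm_minus_commute, simp add: sum_subtractf)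
  also have "\<dots> \<le> (\<Sum>h<H. 2 * real H)"
  proof (intro sum_norm_le)
    fix h assume "h \<in> {..<H}"
    hence "real h \<le> real H" by simp
    with norm_sum_shift_diff_le[where u = u and N = N and h = h, OF assms]
    show "norm ((\<Sum>k<N. u (k + h)) - (\<Sum>k<N. u k)) \<le> 2 * real H"
      by linarith
  qed
  finally have 1: "norm (of_nat H * (\<Sum>k<N. u k) - A) \<le> 2 * (real H)\<^sup>2"
    by (simp add: power2_eq_square)
  have "(norm A)\<^sup>2 \<le> (\<Sum>k<N. norm (\<Sum>h<H. u (k + h)))\<^sup>2"
    unfolding A_def by (intro power_mono norm_sum) auto
  also have "\<dots> \<le> (\<Sum>k<N. (norm (\<Sum>h<H. u (k + h)))\<^sup>2) * card {..<N}"
    by (rule sum_squared_le_sum_of_squares)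
  also have "(\<Sum>k<N. (norm (\<Sum>h<H. u (k + h)))\<^sup>2) =
     norm (\<Sum>k<N. (\<Sum>h<H. u (k + h)) * cnj (\<Sum>h<H. u (k + h)))"
  proof -
    have "(\<Sum>k<N. (\<Sum>h<H. u (k + h)) * cnj (\<Sum>h<H. u (k + h))) =
        complex_of_real (\<Sum>k<N. (norm (\<Sum>h<H. u (k + h)))\<^sup>2)"
      by (simp only: complex_norm_square [symmetric] of_real_sum)
    also have "norm \<dots> = (\<Sum>k<N. (norm (\<Sum>h<H. u (k + h)))\<^sup>2)"
      by (simp only: norm_of_real) (simp add: sum_nonneg)
    finally show ?thesis by simp
  qed
  also have "(\<Sum>k<N. (\<Sum>h<H. u (k + h)) * cnj (\<Sum>h<H. u (k + h))) =
      (\<Sum>h<H. \<Sum>h'<H. \<Sum>k<N. u (k + h) * cnj (u (k + h')))"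
    unfolding cnj_sum sum_product by (subst sum.swap, rule sum.cong[OF refl], rule sum.swap)
  also have "\<dots> = of_nat N * (\<Sum>h<H. \<Sum>h'<H. mean (\<lambda>k. u (k + h) * cnj (u (k + h'))) N)"
    by (simp only: sum_eq sum_distrib_left)
  finally have "(norm A)\<^sup>2 \<le> (real N)\<^sup>2 * norm (\<Sum>h<H. \<Sum>h'<H. mean (\<lambda>k. u (k + h) * cnj (u (k + h'))) N)"
    by (simp add: norm_mult power2_eq_square algebra_simps)
  from real_sqrt_le_mono[OF this]
  have 2: "norm A \<le> real N * sqrt (norm (\<Sum>h<H. \<Sum>h'<H. mean (\<lambda>k. u (k + h) * cnj (u (k + h'))) N))"
    by (simp add: real_sqrt_mult)
  have "real H * norm (\<Sum>k<N. u k) \<le> norm A + 2 * (real H)\<^sup>2"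
    using 1 norm_triangle_ineq2[of "of_nat H * (\<Sum>k<N. u k)" A] by (simp add: norm_mult)
  with 2 have "real H * norm (\<Sum>k<N. u k) / real N \<le>
     (real N * sqrt (norm (\<Sum>h<H. \<Sum>h'<H. mean (\<lambda>k. u (k + h) * cnj (u (k + h'))) N)) + 2 * (real H)\<^sup>2) / real N"
    by (intro divide_right_mono) auto
  with False show ?thesis
    by (simp add: mean_def norm_divide add_divide_distrib)
qed (simp add: mean_def)

text \<open>
  If different shifts are asymptotically uncorrelated, only the \<open>H\<close> diagonal terms survive in
  van der Corput's inequality, and it bounds the mean by about \<open>sqrt H / H\<close>.
\<close>
lemma mean_tendsto_0_van_der_corput:
  fixes u :: "nat \<Rightarrow> complex"
  assumes norm: "\<And>k. norm (u k) \<le> 1"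
    and corr: "\<And>h h'. h \<noteq> h' \<Longrightarrow> mean (\<lambda>k. u (k + h) * cnj (u (k + h'))) \<longlonglongrightarrow> 0"
  shows "mean u \<longlonglongrightarrow> 0"
proof (rule tendstoI)
  fix e :: real assume "e > 0"
  define C where "C H N = (\<Sum>h<H. \<Sum>h'<H. if h = h' then 0
    else norm (mean (\<lambda>k. u (k + h) * cnj (u (k + h'))) N))" for H N
  have "(\<lambda>N. if h = h' then 0 else norm (mean (\<lambda>k. u (k + h) * cnj (u (k + h'))) N))
      \<longlonglongrightarrow> 0" for h h'
    using corr[of h h'] by (cases "h = h'") (auto intro: tendsto_norm_zero)
  hence "C H \<longlonglongrightarrow> (\<Sum>h<H. \<Sum>h'<H. 0)" for H
    unfolding C_def by (intro tendsto_sum)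
  hence C: "C H \<longlonglongrightarrow> 0" for H by simp
  have bound: "real H * norm (mean u N) \<le> sqrt (real H + C H N) + 2 * (real H)\<^sup>2 / real N" for H N
  proof -
    have diag: "norm (mean (\<lambda>k. u (k + h) * cnj (u (k + h))) N) \<le> 1" for h
    proof -
      have "norm (\<Sum>k<N. u (k + h) * cnj (u (k + h))) \<le> (\<Sum>k<N. 1)"
        by (intro sum_norm_le) (simp add: norm_mult mult_le_one norm)
      thus ?thesis by (simp add: mean_def norm_divide divide_le_eq)
    qed
    have "norm (\<Sum>h<H. \<Sum>h'<H. mean (\<lambda>k. u (k + h) * cnj (u (k + h'))) N) \<le>
        (\<Sum>h<H. \<Sum>h'<H. norm (mean (\<lambda>k. u (k + h) * cnj (u (k + h'))) N))"
      by (rule order_trans[OF norm_sum sum_mono]) (rule norm_sum)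
    also have "\<dots> \<le> (\<Sum>h<H. \<Sum>h'<H. (if h = h' then 1 else 0) +
        (if h = h' then 0 else norm (mean (\<lambda>k. u (k + h) * cnj (u (k + h'))) N)))"
      by (intro sum_mono) (use diag in auto)
    also have "\<dots> = real H + C H N"
      by (simp add: sum.distrib C_def)
    finally have "sqrt (norm (\<Sum>h<H. \<Sum>h'<H. mean (\<lambda>k. u (k + h) * cnj (u (k + h'))) N))
       \<le> sqrt (real H + C H N)" by simp
    with van_der_corput_inequality[of u H N, OF norm] show ?thesis by linarith
  qed
  have "(\<lambda>H. (sqrt (real H) + 0) / real H) \<longlonglongrightarrow> 0" by real_asymp
  hence "\<forall>\<^sub>F H in sequentially. (sqrt (real H) + 0) / real H < e \<and> H > 0"
    using \<open>e > 0\<close> by (intro eventually_conj order_tendstoD(2) eventually_gt_at_top) auto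
  then obtain H where H: "sqrt (real H) / real H < e" "H > 0"
    by (auto simp: eventually_sequentially)
  have "(\<lambda>N. (sqrt (real H + C H N) + 2 * (real H)\<^sup>2 / real N) / real H)
      \<longlonglongrightarrow> (sqrt (real H + 0) + 0) / real H"
    using \<open>H > 0\<close> by (intro tendsto_intros C lim_const_over_n) auto
  with H have "\<forall>\<^sub>F N in sequentially. (sqrt (real H + C H N) + 2 * (real H)\<^sup>2 / real N) / real H < e"
    by (intro order_tendstoD(2)) auto
  thus "\<forall>\<^sub>F N in sequentially. dist (mean u N) 0 < e"
  proof eventually_elim
    case (elim N)
    have "norm (mean u N) \<le> (sqrt (real H + C H N) + 2 * (real H)\<^sup>2 / real N) / real H"
      using bound[of H N] H(2) by (simp add: field_simps)
    with elim show ?case by simp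
  qed
qed

section \<open>Weyl sums of polynomials\<close>

lemma coeff_pcompose_shift:
  fixes p :: "'a::comm_ring_1 poly"
  shows "coeff (pcompose p [:h, 1:]) i = (\<Sum>l\<le>degree p. coeff p l * (of_nat (l choose i) * h ^ (l - i)))"
proof -
  have pow: "pcompose (q ^ n) r = pcompose q r ^ n" for q r :: "'a poly" and n
    by (induction n) (simp_all add: pcompose_mult pcompose_1)
  have "coeff ([:h, 1:] ^ l) i = of_nat (l choose i) * h ^ (l - i)" for l
  proof (cases "i \<le> l")
    case False
    hence "degree ([:h, 1:] ^ l) < i"
      using degree_power_le[of "[:h, 1:]" l] by (simp split: if_splits)
    with False show ?thesis by (simp add: coeff_eq_0 binomial_eq_0)
  qed (simp add: coeff_linear_poly_power)
  moreover have "pcompose p [:h, 1:] = (\<Sum>l\<le>degree p. smult (coeff p l) ([:h, 1:] ^ l))"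
    by (subst (1) poly_as_sum_of_monoms [symmetric], subst pcompose_sum)
       (simp add: monom_altdef pcompose_smult pcompose_pCons pow)
  ultimately show ?thesis
    by (simp add: coeff_sum)
qed

text \<open>
  The difference of two distinct rational shifts of \<open>p\<close> is one step closer to the linear case: the
  largest index of an irrational coefficient goes down by one.
\<close>
lemma coeff_pcompose_shift_diff:
  fixes p :: "real poly"
  defines "D h h' \<equiv> pcompose p [:h, 1:] - pcompose p [:h', 1:]"
  assumes rat: "\<And>i. i > Suc n \<Longrightarrow> coeff p i \<in> \<rat>" and h: "h \<in> \<rat>" "h' \<in> \<rat>"
  shows "i > n \<Longrightarrow> coeff (D h h') i \<in> \<rat>"
    and "coeff (D h h') n - of_nat (Suc n) * (h - h') * coeff p (Suc n) \<in> \<rat>"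
proof -
  define t where "t i l = coeff p l * (of_nat (l choose i) * (h ^ (l - i) - h' ^ (l - i)))" for i l
  have D: "coeff (D h h') i = (\<Sum>l\<le>degree p. t i l)" for i
    unfolding D_def t_def coeff_diff coeff_pcompose_shift
    by (simp add: sum_subtractf [symmetric] algebra_simps)
  have t_rat: "t i l \<in> \<rat>" if "l \<le> i \<or> l > Suc n" for i l
    using that rat[of l] h by (cases "l \<le> i") (auto simp: t_def binomial_eq_0 intro!: Rats_mult Rats_diff Rats_power)
  show "coeff (D h h') i \<in> \<rat>" if "i > n"
    unfolding D using that by (intro Rats_sum t_rat) auto
  have "(\<Sum>l\<le>degree p. t n l) = (\<Sum>l\<in>{..degree p} - {Suc n}. t n l) + t n (Suc n)"
  proof (cases "Suc n \<le> degree p")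
    case False
    thus ?thesis by (simp add: t_def coeff_eq_0)
  qed (simp add: sum.remove)
  also have "t n (Suc n) = of_nat (Suc n) * (h - h') * coeff p (Suc n)"
    by (simp add: t_def algebra_simps)
  finally have "coeff (D h h') n - of_nat (Suc n) * (h - h') * coeff p (Suc n) = (\<Sum>l\<in>{..degree p} - {Suc n}. t n l)"
    by (simp add: D)
  also have "\<dots> \<in> \<rat>" by (intro Rats_sum t_rat) auto
  finally show "coeff (D h h') n - of_nat (Suc n) * (h - h') * coeff p (Suc n) \<in> \<rat>" .
qed

lemma common_denominator:
  fixes f :: "'b \<Rightarrow> 'a::field_char_0"
  assumes "finite A" "\<And>x. x \<in> A \<Longrightarrow> f x \<in> \<rat>"
  obtains d :: nat where "d > 0" "\<And>x. x \<in> A \<Longrightarrow> of_nat d * f x \<in> \<int>"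
proof -
  have "\<exists>d::nat. d > 0 \<and> (\<forall>x\<in>A. of_nat d * f x \<in> \<int>)"
    using assms
  proof (induction rule: finite_induct)
    case (insert x A)
    then obtain d where d: "d > 0" "\<forall>x\<in>A. of_nat d * f x \<in> \<int>" by auto
    from insert.prems[of x] obtain a b where ab: "b > 0" "f x = of_int a / of_int b"
      by (auto elim: Rats_cases')
    have "of_nat (d * nat b) * f y \<in> \<int>" if "y \<in> insert x A" for y
    proof (cases "y = x")
      case True
      have "of_nat (d * nat b) * f x = of_int (int d * a)"
        using ab by simp
      with True show ?thesis by (metis Ints_of_int)
    next
      case False
      with that d have "of_nat d * f y \<in> \<int>" by auto
      hence "of_nat (nat b) * (of_nat d * f y) \<in> \<int>" by (rule Ints_mult[OF Ints_of_nat])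
      thus ?thesis by (simp add: mult_ac)
    qed
    with d ab show ?case by (intro exI[of _ "d * nat b"]) auto
  qed (auto intro: exI[of _ 1])
  with that show ?thesis by blast
qed

lemma cis_2pi_eq_1_iff: "cis (2 * pi * t) = 1 \<longleftrightarrow> t \<in> \<int>"
  unfolding cis_eq_1_iff by (auto elim: Ints_cases)

text \<open>
  Weyl's theorem on exponential sums. The induction is on the largest index of an irrational
  coefficient instead of the degree, so that an irrational coefficient below a rational leading one
  needs no separate treatment.
\<close>
theorem mean_cis_poly_tendsto_0:
  fixes p :: "real poly"
  assumes "\<exists>i\<ge>1. coeff p i \<notin> \<rat>"
  shows "mean (\<lambda>k. cis (2 * pi * poly p (real k))) \<longlonglongrightarrow> 0"
proof -
  have *: "mean (\<lambda>k. cis (2 * pi * poly p (real k))) \<longlonglongrightarrow> 0"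
    if "coeff p (Suc n) \<notin> \<rat>" "\<And>i. i > Suc n \<Longrightarrow> coeff p i \<in> \<rat>" for n p
    using that
  proof (induction n arbitrary: p)
    case 0
    obtain d :: nat where d: "d > 0" "\<And>i. i \<in> {2..degree p} \<Longrightarrow> of_nat d * coeff p i \<in> \<int>"
      by (rule common_denominator[of "{2..degree p}" "coeff p"]) (use 0 in auto)
    \<comment> \<open>Shifting by \<open>d\<close> changes the terms of degree at least 2 by integers, and the linear one by \<open>d * coeff p 1\<close>.\<close>
    show ?case
    proof (rule mean_tendsto_0_if_quasiperiodic[where q = d])
      fix k
      have poly_eq: "poly p x = (\<Sum>i\<in>{2..degree p}. coeff p i * x ^ i) + coeff p 1 * x + coeff p 0" for x
      proof -
        have "poly p x = (\<Sum>i\<in>{..degree p} \<union> {0,1}. coeff p i * x ^ i)"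
          unfolding poly_altdef by (rule sum.mono_neutral_left) (auto simp: coeff_eq_0)
        also have "{..degree p} \<union> {0,1} = {2..degree p} \<union> {0,1}" by auto
        also have "(\<Sum>i\<in>\<dots>. coeff p i * x ^ i) = (\<Sum>i\<in>{2..degree p}. coeff p i * x ^ i) + coeff p 1 * x + coeff p 0"
          by (subst sum.union_disjoint) auto
        finally show ?thesis .
      qed
      have "coeff p i * real (k + d) ^ i - coeff p i * real k ^ i \<in> \<int>" if "i \<in> {2..degree p}" for i
      proof -
        have "int (k + d) - int k dvd int (k + d) ^ i - int k ^ i"
          by (subst power_diff_sumr2) simp
        hence "int d dvd int (k + d) ^ i - int k ^ i" by simp
        then obtain c where "int (k + d) ^ i - int k ^ i = int d * c" ..
        hence "real_of_int (int (k + d) ^ i - int k ^ i) = real_of_int (int d * c)" by simp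
        hence "coeff p i * real (k + d) ^ i - coeff p i * real k ^ i = (real d * coeff p i) * of_int c"
          by (simp add: right_diff_distrib [symmetric])
        thus ?thesis using d(2)[OF that] by simp
      qed
      hence int: "(\<Sum>i\<in>{2..degree p}. coeff p i * real (k + d) ^ i - coeff p i * real k ^ i) \<in> \<int>"
        by (rule Ints_sum)
      have "poly p (real (k + d)) = poly p (real k) + real d * coeff p 1 +
        (\<Sum>i\<in>{2..degree p}. coeff p i * real (k + d) ^ i - coeff p i * real k ^ i)"
        by (simp add: poly_eq sum_subtractf algebra_simps)
      hence "cis (2 * pi * poly p (real (k + d))) = cis (2 * pi * poly p (real k)) * cis (2 * pi * (real d * coeff p 1)) *
         cis (2 * pi * (\<Sum>i\<in>{2..degree p}. coeff p i * real (k + d) ^ i - coeff p i * real k ^ i))"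
        by (simp only: cis_mult ring_distribs)
      also have "cis (2 * pi * (\<Sum>i\<in>{2..degree p}. coeff p i * real (k + d) ^ i - coeff p i * real k ^ i)) = 1"
        using int by (simp only: cis_2pi_eq_1_iff)
      finally show "cis (2 * pi * poly p (real (k + d))) =
         cis (2 * pi * (real d * coeff p 1)) * cis (2 * pi * poly p (real k))"
        by simp
    next
      have "real d * coeff p 1 \<notin> \<rat>"
      proof
        assume "real d * coeff p 1 \<in> \<rat>"
        hence "real d * coeff p 1 / real d \<in> \<rat>" by (intro Rats_divide) auto
        with d 0 show False by simp
      qed
      thus "cis (2 * pi * (real d * coeff p 1)) \<noteq> 1"
        unfolding cis_2pi_eq_1_iff using Ints_subset_Rats by auto
    qed auto
  next
    case (Suc n)
    show ?case
    proof (rule mean_tendsto_0_van_der_corput)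
      fix h h' :: nat assume "h \<noteq> h'"
      define q where "q = pcompose p [:real h, 1:] - pcompose p [:real h', 1:]"
      have rat: "coeff q (Suc n) - of_nat (Suc (Suc n)) * (real h - real h') * coeff p (Suc (Suc n)) \<in> \<rat>"
        unfolding q_def by (rule coeff_pcompose_shift_diff(2)) (use Suc.prems in auto)
      have "coeff q (Suc n) \<notin> \<rat>"
      proof
        assume "coeff q (Suc n) \<in> \<rat>"
        from Rats_diff[OF this rat]
        have "of_nat (Suc (Suc n)) * (real h - real h') * coeff p (Suc (Suc n)) \<in> \<rat>" by simp
        hence "of_nat (Suc (Suc n)) * (real h - real h') * coeff p (Suc (Suc n)) /
           (of_nat (Suc (Suc n)) * (real h - real h')) \<in> \<rat>"
          by (intro Rats_divide) (auto intro!: Rats_mult Rats_diff)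
        also have "of_nat (Suc (Suc n)) * (real h - real h') * coeff p (Suc (Suc n)) /
           (of_nat (Suc (Suc n)) * (real h - real h')) = coeff p (Suc (Suc n))"
          using \<open>h \<noteq> h'\<close> by (intro nonzero_mult_div_cancel_left) (auto simp del: of_nat_Suc)
        finally show False using Suc.prems by simp
      qed
      moreover have "coeff q i \<in> \<rat>" if "i > Suc n" for i
        unfolding q_def by (rule coeff_pcompose_shift_diff(1)[OF _ _ _ that]) (use Suc.prems in auto)
      ultimately have "mean (\<lambda>k. cis (2 * pi * poly q (real k))) \<longlonglongrightarrow> 0"
        by (rule Suc.IH)
      also have "(\<lambda>k. cis (2 * pi * poly q (real k))) =
         (\<lambda>k. cis (2 * pi * poly p (real (k + h))) * cnj (cis (2 * pi * poly p (real (k + h')))))"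
        by (simp add: q_def poly_pcompose cis_cnj cis_mult algebra_simps)
      finally show "mean (\<lambda>k. cis (2 * pi * poly p (real (k + h))) *
          cnj (cis (2 * pi * poly p (real (k + h'))))) \<longlonglongrightarrow> 0" .
    qed auto
  qed
  define n where "n = Max {i. coeff p i \<notin> \<rat>}"
  have fin: "finite {i. coeff p i \<notin> \<rat>}"
    by (rule finite_subset[of _ "{..degree p}"]) (auto simp: coeff_eq_0 intro!: leI)
  have "{i. coeff p i \<notin> \<rat>} \<noteq> {}" using assms by blast
  with fin have "n \<in> {i. coeff p i \<notin> \<rat>}"
    unfolding n_def by (rule Max_in)
  moreover have "i \<le> n" if "coeff p i \<notin> \<rat>" for i
    unfolding n_def using fin that by (intro Max_ge) auto
  ultimately have "coeff p (Suc (n - 1)) \<notin> \<rat>" "\<And>i. i > Suc (n - 1) \<Longrightarrow> coeff p i \<in> \<rat>"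
    using assms by fastforce+
  thus ?thesis by (rule *)
qed

section \<open>From Weyl sums to the distribution in arcs\<close>

text \<open>
  On the unit circle \<open>cnj z\<close> is \<open>1 / z\<close>, so a real polynomial function is a Laurent polynomial
  there. Clearing the denominator by a power of \<open>z\<close> makes this class visibly closed under
  products.
\<close>
lemma real_polynomial_function_on_circle:
  fixes g :: "complex \<Rightarrow> real"
  assumes "real_polynomial_function g"
  shows "\<exists>m q. \<forall>z. norm z = 1 \<longrightarrow> complex_of_real (g z) * z ^ m = poly q z"
  using assms
proof induction
  case (linear g)
  interpret bounded_linear g by fact
  have "complex_of_real (g z) * z ^ 1 = poly (smult (1 / 2) [:g 1 + \<i> * g \<i>, 0, g 1 - \<i> * g \<i>:]) z"
    if z: "norm z = 1" for z
  proof -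
    have "g z = g (Re z *\<^sub>R 1 + Im z *\<^sub>R \<i>)"
      by (rule arg_cong[of _ _ g]) (simp add: complex_eq_iff)
    also have "\<dots> = Re z * g 1 + Im z * g \<i>"
      by (simp only: add scaleR) simp
    finally have "g z = Re z * g 1 + Im z * g \<i>" .
    moreover have alg: "2 * ((X * A + Y * B) * (X + I * Y)) = (A + I * B) + (A - I * B) * (X + I * Y) * (X + I * Y)"
      if "I * I = -1" "X * X + Y * Y = 1" for A B X Y I :: complex
      using that by Groebner_Basis.algebra
    have "(Re z)\<^sup>2 + (Im z)\<^sup>2 = 1"
      using z by (simp add: cmod_power2 [symmetric])
    hence "complex_of_real (Re z) * complex_of_real (Re z) + complex_of_real (Im z) * complex_of_real (Im z) = 1"
      by (simp flip: of_real_mult of_real_add add: power2_eq_square)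
    note alg[OF _ this, of \<i> "complex_of_real (g 1)" "complex_of_real (g \<i>)"]
    ultimately have "2 * (complex_of_real (g z) * z) = (g 1 + \<i> * g \<i>) + (g 1 - \<i> * g \<i>) * z * z"
      by (simp add: complex_eq [symmetric])
    hence "2 * (complex_of_real (g z) * z) = poly [:g 1 + \<i> * g \<i>, 0, g 1 - \<i> * g \<i>:] z"
      by (simp add: mult_ac)
    thus ?thesis
      unfolding poly_smult by (simp del: poly_pCons add: mult.commute[of _ 2])
  qed
  thus ?case by blast
next
  case (const c)
  show ?case by (rule exI[of _ 0], rule exI[of _ "[:complex_of_real c:]"]) simp
next
  case (add f g)
  then obtain m q n r where "\<And>z. norm z = 1 \<Longrightarrow> complex_of_real (f z) * z ^ m = poly q z"
      "\<And>z. norm z = 1 \<Longrightarrow> complex_of_real (g z) * z ^ n = poly r z" by blast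
  hence "\<forall>z. norm z = 1 \<longrightarrow> complex_of_real (f z + g z) * z ^ (m + n) = poly (q * monom 1 n + r * monom 1 m) z"
    by (simp add: poly_monom power_add algebra_simps)
  thus ?case by blast
next
  case (mult f g)
  then obtain m q n r where "\<And>z. norm z = 1 \<Longrightarrow> complex_of_real (f z) * z ^ m = poly q z"
      "\<And>z. norm z = 1 \<Longrightarrow> complex_of_real (g z) * z ^ n = poly r z" by blast
  hence "\<forall>z. norm z = 1 \<longrightarrow> complex_of_real (f z * g z) * z ^ (m + n) = poly (q * r) z"
    by (simp add: power_add mult_ac)
  thus ?case by blast
qed

lemma mean_const: "(\<lambda>N. mean (\<lambda>_. c) N) \<longlonglongrightarrow> c"
proof (rule tendsto_eventually)
  show "\<forall>\<^sub>F N in sequentially. mean (\<lambda>_. c) N = c"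
    using eventually_gt_at_top[of 0] by eventually_elim (simp add: mean_def)
qed

lemma mean_cmult: "mean (\<lambda>k. c * u k) = (\<lambda>N. c * mean u N)"
  by (simp add: mean_def fun_eq_iff sum_distrib_left)

lemma mean_cnj: "mean (\<lambda>k. cnj (u k)) = (\<lambda>N. cnj (mean u N))"
  by (simp add: mean_def fun_eq_iff)

lemma mean_sum: "mean (\<lambda>k. \<Sum>i\<in>I. u i k) = (\<lambda>N. \<Sum>i\<in>I. mean (u i) N)"
  unfolding mean_def sum_divide_distrib [symmetric] by (subst sum.swap) simp

text \<open>
  In the Laurent expansion every nonconstant term has mean 0 in the limit, whatever the rotation
  \<open>w\<close>; the limit \<open>c\<close> is the constant term.
\<close>
lemma mean_real_polynomial_function_rotation_invariant:
  fixes g :: "complex \<Rightarrow> real" and z :: "nat \<Rightarrow> complex"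
  assumes g: "real_polynomial_function g"
    and z: "\<And>k. norm (z k) = 1" and weyl: "\<And>n. n > 0 \<Longrightarrow> mean (\<lambda>k. z k ^ n) \<longlonglongrightarrow> 0"
  shows "\<exists>c. \<forall>w. norm w = 1 \<longrightarrow> (\<lambda>N. (\<Sum>k<N. g (w * z k)) / real N) \<longlonglongrightarrow> c"
proof -
  obtain m q where q: "\<And>z. norm z = 1 \<Longrightarrow> complex_of_real (g z) * z ^ m = poly q z"
    using real_polynomial_function_on_circle[OF g] by blast
  have g_eq: "complex_of_real (g v) = (\<Sum>i\<le>degree q. coeff q i * (v ^ i * cnj v ^ m))" if "norm v = 1" for v
  proof -
    have "complex_of_real (g v) = complex_of_real (g v) * (v ^ m * cnj v ^ m)"
      using that by (simp add: power_mult_distrib [symmetric] complex_norm_square [symmetric])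
    also have "\<dots> = poly q v * cnj v ^ m"
      using q[OF that] by (simp add: mult_ac)
    finally show ?thesis
      by (simp add: poly_altdef sum_distrib_right mult.assoc)
  qed
  have "(\<lambda>N. (\<Sum>k<N. g (w * z k)) / real N) \<longlonglongrightarrow> Re (coeff q m)" if w: "norm w = 1" for w
  proof -
    define v where "v k = w * z k" for k
    have v: "norm (v k) = 1" for k by (simp add: v_def norm_mult w z)
    have vv: "v k * cnj (v k) = 1" for k
      using v[of k] by (simp add: complex_norm_square [symmetric])
    have v_pow: "mean (\<lambda>k. v k ^ n) \<longlonglongrightarrow> 0" if "n > 0" for n
      using tendsto_mult_right_zero[OF weyl[OF that], of "w ^ n"]
      by (simp add: v_def power_mult_distrib mean_cmult)
    have "mean (\<lambda>k. v k ^ i * cnj (v k) ^ m) \<longlonglongrightarrow> (if i = m then 1 else 0)" for i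
    proof (cases i m rule: linorder_cases)
      case equal
      thus ?thesis using vv mean_const[of 1] by (simp add: power_mult_distrib [symmetric])
    next
      case greater
      then obtain d where d: "i = m + d" "d > 0" using less_imp_add_positive by blast
      have "v k ^ i * cnj (v k) ^ m = v k ^ d" for k
        using vv[of k] by (simp add: d power_add mult_ac power_mult_distrib [symmetric] mult.left_commute)
      with v_pow[OF d(2)] greater show ?thesis by simp
    next
      case less
      then obtain d where d: "m = i + d" "d > 0" using less_imp_add_positive by blast
      have "v k ^ i * cnj (v k) ^ m = cnj (v k ^ d)" for k
        using vv[of k] by (simp add: d power_add mult.assoc [symmetric] power_mult_distrib [symmetric])
      moreover have "mean (\<lambda>k. cnj (v k ^ d)) \<longlonglongrightarrow> cnj 0"
        unfolding mean_cnj by (intro tendsto_cnj v_pow d)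
      ultimately show ?thesis using less by simp
    qed
    hence "(\<lambda>N. \<Sum>i\<le>degree q. coeff q i * mean (\<lambda>k. v k ^ i * cnj (v k) ^ m) N) \<longlonglongrightarrow>
        (\<Sum>i\<le>degree q. coeff q i * (if i = m then 1 else 0))"
      by (intro tendsto_intros)
    also have "(\<Sum>i\<le>degree q. coeff q i * (if i = m then 1 else 0)) = coeff q m"
      by (simp add: sum.delta if_distrib[of "\<lambda>x. _ * x"] coeff_eq_0 cong: if_cong)
    also have "(\<lambda>N. \<Sum>i\<le>degree q. coeff q i * mean (\<lambda>k. v k ^ i * cnj (v k) ^ m) N) =
        mean (\<lambda>k. complex_of_real (g (v k)))"
      by (simp add: fun_eq_iff g_eq[OF v] mean_sum mean_cmult)
    finally have "(\<lambda>N. Re (mean (\<lambda>k. complex_of_real (g (v k))) N)) \<longlonglongrightarrow> Re (coeff q m)"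
      by (rule tendsto_Re)
    also have "(\<lambda>N. Re (mean (\<lambda>k. complex_of_real (g (v k))) N)) = (\<lambda>N. (\<Sum>k<N. g (w * z k)) / real N)"
      by (simp add: mean_def v_def fun_eq_iff Re_divide_of_nat)
    finally show ?thesis .
  qed
  thus ?thesis by blast
qed

text \<open>
  Scaled by \<open>D\<close>, the points \<open>t + s / D\<close> have spacing 1. Those that avoid the closed arc can be
  translated by integers into a half-open interval of scaled length \<open>L + 2\<close>: the arc from
  \<open>j/m\<close> to \<open>(j+1)/m\<close> enlarged by \<open>1/D\<close> at both ends.
\<close>
lemma card_rotations_near_arc:
  fixes j :: int and m L :: nat and t :: real
  assumes "m > 0" "L > 0"
  defines "D \<equiv> real (m * L)"
  shows "card {s \<in> {..<m * L}. cis (2 * pi * (t + real s / D)) \<notin>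
     (\<lambda>y. cis (2 * pi * y)) ` {(real_of_int j + 1) / m + 1 / D .. j / m + 1 - 1 / D}} \<le> L + 2"
    (is "card ?S \<le> _")
proof -
  have D: "D > 0" unfolding D_def using assms by simp
  \<comment> \<open>The translate of \<open>t + s / D\<close> by \<open>n s\<close> lies in the period that starts at \<open>j / m - 1 / D\<close>;
    \<open>v s\<close> is the integer part of \<open>D\<close> times this translate.\<close>
  define n where "n s = - \<lfloor>t + real s / D - j / m + 1 / D\<rfloor>" for s
  define v where "v s = \<lfloor>D * t\<rfloor> + int s + n s * int (m * L)" for s
  have "v s \<in> {j * int L - 1 ..< j * int L + int L + 1}" if "s \<in> ?S" for s
  proof -
    define y where "y = t + real s / D + of_int (n s)"
    have y: "y \<ge> j / m - 1 / D" "y < j / m - 1 / D + 1"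
      unfolding y_def n_def by linarith+
    have "cis (2 * pi * y) = cis (2 * pi * (t + real s / D)) * cis (2 * pi * of_int (n s))"
      unfolding y_def cis_mult by (simp add: algebra_simps)
    also have "cis (2 * pi * of_int (n s)) = 1" by simp
    finally have cis_y: "cis (2 * pi * y) = cis (2 * pi * (t + real s / D))" by simp
    have "y \<notin> {(real_of_int j + 1) / m + 1 / D .. j / m + 1 - 1 / D}"
    proof
      assume "y \<in> {(real_of_int j + 1) / m + 1 / D .. j / m + 1 - 1 / D}"
      hence "cis (2 * pi * y) \<in> (\<lambda>y. cis (2 * pi * y)) ` {(real_of_int j + 1) / m + 1 / D .. j / m + 1 - 1 / D}"
        by (rule imageI)
      with that show False unfolding cis_y by simp
    qed
    with y have y': "y < (real_of_int j + 1) / m + 1 / D" by auto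
    have eq: "D * (j / m - 1 / D) = j * L - 1" "D * ((real_of_int j + 1) / m + 1 / D) = j * L + L + 1"
      using D assms(1,2) by (simp_all add: D_def field_simps)
    have "D * y \<ge> j * L - 1" "D * y < j * L + L + 1"
      using mult_left_mono[OF y(1), of D] mult_strict_left_mono[OF y', of D] D unfolding eq by auto
    moreover have "D * y = D * t + real s + of_int (n s) * D"
      using D by (simp add: y_def field_simps)
    moreover have "\<lfloor>D * t + real s + of_int (n s) * D\<rfloor> = v s"
    proof -
      have "D * t + real s + of_int (n s) * D = D * t + of_int (int s + n s * int (m * L))"
        by (simp add: D_def)
      thus ?thesis unfolding v_def by (simp only: floor_add_int) simp
    qed
    ultimately show ?thesis
      using le_floor_iff[of "j * int L - 1" "D * y"] floor_less_iff[of "D * y" "j * int L + int L + 1"]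
      by simp
  qed
  moreover have "inj_on v ?S"
  proof
    fix s s' assume s: "s \<in> ?S" "s' \<in> ?S" "v s = v s'"
    hence "(int s + n s * int (m * L)) mod int (m * L) = (int s' + n s' * int (m * L)) mod int (m * L)"
      by (simp add: v_def)
    with s show "s = s'" by (simp del: of_nat_mult)
  qed
  ultimately have "card ?S \<le> card {j * int L - 1 ..< j * int L + int L + 1}"
    by (intro card_inj_on_le) auto
  thus ?thesis by simp
qed

text \<open>
  A continuous bump function \<open>\<phi>\<close> that is 1 on the arc and 0 a little outside of it is
  approximated by a polynomial function \<open>g\<close>. The limit of the averages of \<open>g\<close> does not depend on a
  rotation, so it is at most the supremum of the average of \<open>\<phi>\<close> over \<open>m L\<close> rotations of one
  point, plus \<open>\<delta>\<close>.
\<close>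
lemma upper_density_arc:
  fixes x :: "nat \<Rightarrow> real" and m :: nat and j :: int
  assumes m: "m > 0" and weyl: "\<And>n. n > 0 \<Longrightarrow> mean (\<lambda>k. cis (2 * pi * x k) ^ n) \<longlonglongrightarrow> 0"
    and e: "e > 0"
  shows "\<forall>\<^sub>F N in sequentially.
    card {k \<in> {..<N}. \<exists>n::int. j / m \<le> x k + n \<and> x k + n < (j + 1) / m} / real N \<le> 1 / m + e"
proof -
  \<comment> \<open>The enlargement of the arc by \<open>1/D\<close> at both ends costs \<open>2 / (m L)\<close>.\<close>
  have "(\<lambda>L. 2 / (m * real L)) \<longlonglongrightarrow> 0" using m by real_asymp
  hence "\<forall>\<^sub>F L in sequentially. 2 / (m * real L) < e / 2 \<and> L > 0"
    using e by (intro eventually_conj order_tendstoD(2) eventually_gt_at_top) auto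
  then obtain L :: nat where L: "2 / (m * real L) < e / 2" "L > 0"
    by (auto simp: eventually_sequentially)
  define D where "D = real (m * L)"
  have D: "D > 0" using m L by (simp add: D_def)
  define f where "f y = cis (2 * pi * y)" for y
  define A where "A = f ` {j / m .. (real_of_int j + 1) / m}"
  define C where "C = f ` {(real_of_int j + 1) / m + 1 / D .. j / m + 1 - 1 / D}"
  have cont: "continuous_on X f" for X
    unfolding f_def by (intro continuous_intros)
  have AC: "closed A" "closed C"
    unfolding A_def C_def by (intro compact_imp_closed compact_continuous_image cont compact_Icc)+
  have disj: "A \<inter> C = {}"
  proof (rule ccontr)
    assume "A \<inter> C \<noteq> {}"
    then obtain s t where st: "s \<in> {j / m .. (real_of_int j + 1) / m}"
        "t \<in> {(real_of_int j + 1) / m + 1 / D .. j / m + 1 - 1 / D}" "f s = f t"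
      unfolding A_def C_def by blast
    have "cis (2 * pi * (t - s)) = f t / f s"
      by (simp add: f_def cis_divide algebra_simps)
    also have "\<dots> = 1" using st(3) by (simp add: f_def)
    finally obtain i :: int where "t - s = i" unfolding cis_2pi_eq_1_iff by (auto elim: Ints_cases)
    moreover have "0 < 1 / D" using D by simp
    hence "0 < t - s" "t - s < 1" using st(1,2) unfolding atLeastAtMost_iff by linarith+
    ultimately show False by simp
  qed
  obtain \<phi> :: "complex \<Rightarrow> real" where \<phi>: "continuous_on UNIV \<phi>"
      "\<And>w. \<phi> w \<in> closed_segment 1 0" "\<And>w. w \<in> A \<Longrightarrow> \<phi> w = 1" "\<And>w. w \<in> C \<Longrightarrow> \<phi> w = 0"
    using Urysohn[OF AC disj, of 1 0] by metis
  have \<phi>01: "0 \<le> \<phi> w" "\<phi> w \<le> 1" for w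
    using \<phi>(2)[of w] by (auto simp: closed_segment_eq_real_ivl)
  define \<delta> where "\<delta> = e / 6"
  have \<delta>: "\<delta> > 0" using e by (simp add: \<delta>_def)
  obtain g where g: "real_polynomial_function g" "\<And>w. w \<in> sphere 0 1 \<Longrightarrow> \<bar>\<phi> w - g w\<bar> < \<delta>"
    by (rule Stone_Weierstrass_real_polynomial_function[of "sphere 0 1" \<phi> \<delta>])
       (use \<phi>(1) \<delta> in \<open>auto intro: continuous_on_subset\<close>)
  have gphi: "\<bar>\<phi> w - g w\<bar> < \<delta>" if "norm w = 1" for w using g(2)[of w] that by simp
  define z where "z k = f (x k)" for k
  have z: "norm (z k) = 1" for k by (simp add: z_def f_def)
  obtain c where c: "\<And>w. norm w = 1 \<Longrightarrow> (\<lambda>N. (\<Sum>k<N. g (w * z k)) / real N) \<longlonglongrightarrow> c"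
    using mean_real_polynomial_function_rotation_invariant[OF g(1), of z] z weyl
    unfolding z_def f_def by blast
  have "(\<lambda>N. (\<Sum>s<m*L. (\<Sum>k<N. g (f (s / D) * z k)) / real N) / D) \<longlonglongrightarrow> (\<Sum>s<m*L. c) / D"
    using D by (intro tendsto_intros c) (auto simp: f_def)
  also have "(\<Sum>s<m*L. c) / D = c" using m L by (simp add: D_def)
  finally have "(\<lambda>N. (\<Sum>s<m*L. (\<Sum>k<N. g (f (s / D) * z k)) / real N) / D) \<longlonglongrightarrow> c" .
  moreover have "(\<Sum>s<m*L. (\<Sum>k<N. g (f (s / D) * z k)) / real N) / D \<le> (L + 2) / D + \<delta>" for N
  proof (cases "N = 0")
    case False
    have inner: "(\<Sum>s<m*L. g (f (s / D) * z k)) \<le> (L + 2) + D * \<delta>" for k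
    proof -
      define S where "S = {s \<in> {..<m * L}. f (x k + real s / D) \<notin> C}"
      have "g (f (s / D) * z k) \<le> of_bool (s \<in> S) + \<delta>" if "s < m * L" for s
      proof -
        have eq: "f (s / D) * z k = f (x k + s / D)"
          by (simp add: f_def z_def cis_mult algebra_simps)
        have "\<phi> (f (x k + s / D)) \<le> of_bool (s \<in> S)"
          using \<phi>(4) \<phi>01 that by (auto simp: S_def)
        with gphi[of "f (x k + s / D)"] show ?thesis
          unfolding eq by (auto simp: f_def)
      qed
      hence "(\<Sum>s<m*L. g (f (s / D) * z k)) \<le> (\<Sum>s<m*L. of_bool (s \<in> S) + \<delta>)"
        by (intro sum_mono) auto
      also have "\<dots> = card S + D * \<delta>"
        by (simp add: sum.distrib D_def S_def Int_def)
      also have "card S \<le> L + 2"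
        unfolding S_def C_def f_def D_def by (rule card_rotations_near_arc[OF m L(2)])
      finally show ?thesis by simp
    qed
    have "(\<Sum>s<m*L. (\<Sum>k<N. g (f (s / D) * z k)) / real N) = (\<Sum>k<N. \<Sum>s<m*L. g (f (s / D) * z k)) / real N"
      unfolding sum_divide_distrib [symmetric] by (subst sum.swap) simp
    also have "\<dots> \<le> (\<Sum>k<N. (L + 2) + D * \<delta>) / real N"
      by (intro divide_right_mono sum_mono inner) auto
    also have "\<dots> = (L + 2) + D * \<delta>" using False by simp
    finally show ?thesis using D by (simp add: field_simps)
  qed (use \<delta> D in simp)
  ultimately have c_le: "c \<le> (L + 2) / D + \<delta>"
    by (intro LIMSEQ_le_const2) auto
  have "(\<lambda>N. (\<Sum>k<N. g (1 * z k)) / real N) \<longlonglongrightarrow> c" by (intro c) simp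
  hence "\<forall>\<^sub>F N in sequentially. (\<Sum>k<N. g (1 * z k)) / real N < c + \<delta>"
    using \<delta> by (intro order_tendstoD(2)) auto
  moreover have "\<forall>\<^sub>F N::nat in sequentially. N > 0" by (rule eventually_gt_at_top)
  ultimately show ?thesis
  proof eventually_elim
    case (elim N)
    define E where "E = {k \<in> {..<N}. \<exists>n::int. j / m \<le> x k + n \<and> x k + n < (j + 1) / m}"
    have "of_bool (k \<in> E) \<le> g (1 * z k) + \<delta>" for k
    proof (cases "k \<in> E")
      case True
      then obtain n :: int where "j / m \<le> x k + n" "x k + n < (real_of_int j + 1) / m"
        by (auto simp: E_def)
      hence "x k + n \<in> {j / m .. (real_of_int j + 1) / m}" by simp
      hence "f (x k + n) \<in> A" unfolding A_def by (rule imageI)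
      also have "f (x k + n) = f (x k) * f n" by (simp add: f_def cis_mult algebra_simps)
      also have "f n = 1" by (simp add: f_def)
      finally have "\<phi> (z k) = 1" by (simp add: z_def \<phi>(3))
      with gphi[OF z[of k]] True show ?thesis by simp
    qed (use gphi[OF z[of k]] \<phi>01(1)[of "z k"] in simp)
    hence "(\<Sum>k<N. of_bool (k \<in> E)) \<le> (\<Sum>k<N. g (1 * z k) + \<delta>)"
      by (intro sum_mono)
    also have "(\<Sum>k<N. of_bool (k \<in> E)) = real (card E)"
      by (simp add: E_def Int_def)
    also have "(\<Sum>k<N. g (1 * z k) + \<delta>) = (\<Sum>k<N. g (1 * z k)) + N * \<delta>"
      by (simp add: sum.distrib)
    finally have "card E / real N \<le> ((\<Sum>k<N. g (1 * z k)) + N * \<delta>) / N"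
      by (intro divide_right_mono) auto
    also have "\<dots> = (\<Sum>k<N. g (1 * z k)) / N + \<delta>"
      using elim by (simp add: field_simps)
    also have "\<dots> \<le> (L + 2) / D + 3 * \<delta>"
      using elim c_le by simp
    also have "(L + 2) / D = 1 / m + 2 / (m * real L)"
      using m L by (simp add: D_def field_simps)
    finally show ?case
      using L(1) unfolding E_def \<delta>_def by simp
  qed
qed

text \<open>
  Finitely many sequences with sum 1 that are all asymptotically at most the reciprocal of their
  number have no room to be smaller.
\<close>
lemma tendsto_if_limsups_sum_to_1:
  fixes f :: "'i \<Rightarrow> nat \<Rightarrow> real"
  assumes I: "finite I" "i \<in> I"
    and sum: "\<forall>\<^sub>F N in sequentially. (\<Sum>i\<in>I. f i N) = 1"
    and upper: "\<And>i e. i \<in> I \<Longrightarrow> e > 0 \<Longrightarrow> \<forall>\<^sub>F N in sequentially. f i N \<le> 1 / card I + e"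
  shows "f i \<longlonglongrightarrow> 1 / card I"
proof (rule tendstoI)
  fix e :: real assume e: "e > 0"
  have cI: "card I > 0" using I card_gt_0_iff by blast
  have "\<forall>\<^sub>F N in sequentially. \<forall>i\<in>I. f i N \<le> 1 / card I + e / (2 * card I)"
    using I e cI by (intro eventually_ball_finite ballI upper) auto
  with sum show "\<forall>\<^sub>F N in sequentially. dist (f i N) (1 / card I) < e"
  proof eventually_elim
    case (elim N)
    have "1 = f i N + (\<Sum>i\<in>I - {i}. f i N)"
      using elim(1) I by (simp add: sum.remove)
    also have "(\<Sum>i\<in>I - {i}. f i N) \<le> (\<Sum>i\<in>I - {i}. 1 / card I + e / (2 * card I))"
      using elim(2) by (intro sum_mono) auto
    also have "\<dots> = (real (card I) - 1) * (1 / card I + e / (2 * card I))"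
      using I cI by (simp add: of_nat_diff Suc_leI)
    also have "\<dots> = 1 - 1 / card I + e / 2 - e / (2 * card I)"
      using cI by (simp add: field_simps)
    finally have "1 \<le> f i N + (1 - 1 / card I + e / 2 - e / (2 * card I))" by simp
    moreover have "e / (2 * card I) \<ge> 0" using e by simp
    ultimately have "f i N \<ge> 1 / card I - e / 2" by linarith
    moreover have "f i N \<le> 1 / card I + e / (2 * card I)"
      using elim I by blast
    moreover have "e / (2 * card I) \<le> e / 2"
      using e cI by (simp add: field_simps)
    ultimately show ?case using e by (auto simp: dist_real_def)
  qed
qed

text \<open>
  The sets of \<open>k\<close> counted for the residue classes modulo \<open>m\<close> are the preimages of arcs of length
  \<open>1/m\<close> under \<open>P (k + 1) / m\<close>; the shift of the index by one accounts for the sequence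
  starting at 1.
\<close>
theorem ud_in_Z_floor_poly:
  assumes "\<exists>i\<ge>1. coeff P i \<notin> \<rat>"
  shows "ud_in_Z (\<lambda>k. \<lfloor>poly P (real k)\<rfloor>)"
  unfolding ud_in_Z_def ud_mod_def
proof (intro allI impI)
  fix m i :: int assume m: "m \<ge> 2"
  define x where "x k = poly P (real (k + 1)) / m" for k
  define f where "f i N = card {k \<in> {1..N}. [\<lfloor>poly P (real k)\<rfloor> = i] (mod m)} / real N" for i N
  have weyl: "mean (\<lambda>k. cis (2 * pi * x k) ^ n) \<longlonglongrightarrow> 0" if n: "n > 0" for n
  proof -
    define p where "p = smult (n / m) P"
    have "coeff p i \<notin> \<rat>" if "coeff P i \<notin> \<rat>" for i
    proof
      assume "coeff p i \<in> \<rat>"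
      hence "coeff p i * m / n \<in> \<rat>" by (intro Rats_divide Rats_mult) auto
      also have "coeff p i * m / n = coeff P i"
        using m n by (simp add: p_def)
      finally show False using that by simp
    qed
    hence "mean (\<lambda>k. cis (2 * pi * poly p (real k))) \<longlonglongrightarrow> 0"
      using assms by (intro mean_cis_poly_tendsto_0) blast
    hence "mean (\<lambda>k. cis (2 * pi * poly p (real (k + 1)))) \<longlonglongrightarrow> 0"
      by (rule mean_shift_tendsto_0[rotated]) auto
    also have "(\<lambda>k. cis (2 * pi * poly p (real (k + 1)))) = (\<lambda>k. cis (2 * pi * x k) ^ n)"
      by (simp add: Complex.DeMoivre x_def p_def mult_ac)
    finally show ?thesis .
  qed
  have mem_iff: "[\<lfloor>poly P (real (k + 1))\<rfloor> = j] (mod m) \<longleftrightarrow>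
      (\<exists>n::int. j / m \<le> x k + n \<and> x k + n < (real_of_int j + 1) / m)" for j k
  proof -
    have "[\<lfloor>poly P (real (k + 1))\<rfloor> = j] (mod m) \<longleftrightarrow> (\<exists>n. j = \<lfloor>poly P (real (k + 1))\<rfloor> + m * n)"
      by (rule cong_iff_lin)
    also have "\<dots> \<longleftrightarrow> (\<exists>n::int. j / m \<le> x k + n \<and> x k + n < (real_of_int j + 1) / m)"
    proof (intro ex_cong1)
      fix n :: int
      have "j = \<lfloor>poly P (real (k + 1))\<rfloor> + m * n \<longleftrightarrow> \<lfloor>poly P (real (k + 1)) + real_of_int (m * n)\<rfloor> = j"
        by (subst floor_add_int [symmetric]) auto
      also have "poly P (real (k + 1)) + real_of_int (m * n) = (x k + n) * m"
        using m by (simp add: x_def field_simps)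
      finally show "j = \<lfloor>poly P (real (k + 1))\<rfloor> + m * n \<longleftrightarrow> j / m \<le> x k + n \<and> x k + n < (real_of_int j + 1) / m"
        using m by (simp add: floor_eq_iff pos_divide_le_eq pos_less_divide_eq)
    qed
    finally show ?thesis .
  qed
  have card_eq: "card {k \<in> {1..N}. [\<lfloor>poly P (real k)\<rfloor> = j] (mod m)} =
      card {k \<in> {..<N}. \<exists>n::int. j / nat m \<le> x k + n \<and> x k + n < (j + 1) / nat m}" for j N
  proof -
    have "{k \<in> {1..N}. [\<lfloor>poly P (real k)\<rfloor> = j] (mod m)} =
        (\<lambda>k. k + 1) ` {k \<in> {..<N}. [\<lfloor>poly P (real (k + 1))\<rfloor> = j] (mod m)}"
      (is "?A = ?B")
    proof (rule Set.set_eqI)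
      fix k show "k \<in> ?A \<longleftrightarrow> k \<in> ?B" by (cases k) (auto simp: image_iff)
    qed
    also have "card \<dots> = card {k \<in> {..<N}. [\<lfloor>poly P (real (k + 1))\<rfloor> = j] (mod m)}"
      by (rule card_image) auto
    finally show ?thesis using m unfolding mem_iff by (simp add: add.commute)
  qed
  have "f (i mod m) \<longlonglongrightarrow> 1 / card {0..<m}"
  proof (rule tendsto_if_limsups_sum_to_1)
    show "\<forall>\<^sub>F N in sequentially. (\<Sum>i\<in>{0..<m}. f i N) = 1"
      using eventually_gt_at_top[of 0]
    proof eventually_elim
      case (elim N)
      have "(\<Sum>i\<in>{0..<m}. card {k \<in> {1..N}. [\<lfloor>poly P (real k)\<rfloor> = i] (mod m)}) =
          card (\<Union>i\<in>{0..<m}. {k \<in> {1..N}. [\<lfloor>poly P (real k)\<rfloor> = i] (mod m)})"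
        by (rule card_UN_disjoint [symmetric]) (auto simp: Cong.cong_def)
      also have "(\<Union>i\<in>{0..<m}. {k \<in> {1..N}. [\<lfloor>poly P (real k)\<rfloor> = i] (mod m)}) = {1..N}"
        using m by (auto simp: Cong.cong_def intro!: bexI[of _ "_ mod m"])
      finally show ?case
        using elim by (simp add: f_def sum_divide_distrib [symmetric] flip: of_nat_sum)
    qed
  next
    fix j e assume "j \<in> {0..<m}" "e > (0::real)"
    thus "\<forall>\<^sub>F N in sequentially. f j N \<le> 1 / card {0..<m} + e"
      using upper_density_arc[of "nat m" x e j] weyl m unfolding f_def card_eq by simp
  qed (use m in auto)
  thus "(\<lambda>N. card {k \<in> {1..N}. [\<lfloor>poly P (real k)\<rfloor> = i] (mod m)} / real N) \<longlonglongrightarrow> 1 / m"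
    using m unfolding f_def by (simp add: Cong.cong_def)
qed

section \<open>Integer polynomials and simple extensions of the rationals\<close>

definition ipoly :: "int poly \<Rightarrow> 'a::comm_ring_1 \<Rightarrow> 'a" where
  "ipoly q x = poly (map_poly of_int q) x"

lemma ipoly_0 [simp]: "ipoly 0 x = 0"
  by (simp add: ipoly_def)

lemma ipoly_pCons [simp]: "ipoly (pCons a q) x = of_int a + x * ipoly q x"
  by (simp add: ipoly_def map_poly_pCons)

lemma ipoly_1 [simp]: "ipoly 1 x = 1"
  by (simp add: one_pCons)

lemma ipoly_add [simp]: "ipoly (p + q) x = ipoly p x + ipoly q x"
  by (induction p q rule: poly_induct2) (auto simp: algebra_simps)

lemma ipoly_smult [simp]: "ipoly (smult a q) x = of_int a * ipoly q x"
  by (induction q) (auto simp: algebra_simps)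

lemma ipoly_uminus [simp]: "ipoly (- p) x = - ipoly p x"
  by (induction p) auto

lemma ipoly_diff [simp]: "ipoly (p - q) x = ipoly p x - ipoly q x"
  using ipoly_add[of p "- q" x] by simp

lemma ipoly_mult [simp]: "ipoly (p * q) x = ipoly p x * ipoly q x"
  by (induction p) (auto simp: algebra_simps)

lemma ipoly_power [simp]: "ipoly (p ^ n) x = ipoly p x ^ n"
  by (induction n) auto

lemma ipoly_prod [simp]: "ipoly (\<Prod>i\<in>A. p i) x = (\<Prod>i\<in>A. ipoly (p i) x)"
  by (induction A rule: infinite_finite_induct) auto

lemma ipoly_of_int [simp]: "ipoly q (of_int a) = of_int (poly q a)"
  by (induction q) auto

lemma ipoly_of_real: "ipoly q (of_real x :: 'a::{real_algebra_1,comm_ring_1}) = of_real (ipoly q x)"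
  by (induction q) auto

lemma ipoly_cnj: "ipoly q (cnj x) = cnj (ipoly q x)"
  by (induction q) auto

lemma algebraic_iff_ipoly:
  fixes x :: "'a::field_char_0"
  shows "algebraic x \<longleftrightarrow> (\<exists>q. q \<noteq> 0 \<and> ipoly q x = 0)"
proof
  assume "algebraic x"
  from algebraicE[OF this] obtain p where p: "\<And>i. coeff p i \<in> \<int>" "p \<noteq> 0" "poly p x = 0" by blast
  define q where "q = map_poly (inv_into UNIV (of_int :: int \<Rightarrow> 'a)) p"
  have "inv_into UNIV (of_int :: int \<Rightarrow> 'a) (of_int 0) = 0"
    by (rule inv_f_f) (auto simp: inj_on_def)
  with p(1) have "p = map_poly of_int q"
    unfolding q_def by (intro poly_eqI) (auto simp: coeff_map_poly f_inv_into_f Ints_def)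
  with p show "\<exists>q. q \<noteq> 0 \<and> ipoly q x = 0" by (intro exI[of _ q]) (auto simp: ipoly_def)
next
  assume "\<exists>q. q \<noteq> 0 \<and> ipoly q x = 0"
  then obtain q where "q \<noteq> 0" "ipoly q x = 0" by blast
  thus "algebraic x"
    by (intro algebraicI[of "map_poly of_int q"]) (auto simp: ipoly_def coeff_map_poly map_poly_eq_0_iff)
qed

text \<open>
  Minimal polynomials are taken among integer polynomials. They are only determined up to a constant
  factor, and division by them is pseudo-division, whose denominators are powers of the leading
  coefficient; hence reduction modulo a prime is harmless as soon as the prime does not divide that
  coefficient.
\<close>
definition is_min_ipoly :: "int poly \<Rightarrow> 'a::comm_ring_1 \<Rightarrow> bool" where
  "is_min_ipoly g x \<longleftrightarrow> g \<noteq> 0 \<and> ipoly g x = 0 \<and>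
     (\<forall>h. h \<noteq> 0 \<longrightarrow> ipoly h x = 0 \<longrightarrow> degree g \<le> degree h)"

lemma is_min_ipolyD:
  "is_min_ipoly g x \<Longrightarrow> ipoly h x = 0 \<Longrightarrow> degree h < degree g \<Longrightarrow> h = 0"
  unfolding is_min_ipoly_def by (metis leD)

lemma ex_min_ipoly:
  fixes x :: "'a::field_char_0"
  assumes "algebraic x"
  obtains g where "is_min_ipoly g x"
proof -
  from assms obtain q where "q \<noteq> 0 \<and> ipoly q x = 0" by (auto simp: algebraic_iff_ipoly)
  from ex_has_least_nat[of "\<lambda>q. q \<noteq> 0 \<and> ipoly q x = 0", OF this, of degree] that
  show ?thesis unfolding is_min_ipoly_def by blast
qed

lemma min_ipoly_degree_pos:
  fixes x :: "'a::field_char_0"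
  assumes "is_min_ipoly g x"
  shows "degree g > 0"
proof (rule ccontr)
  assume "\<not> degree g > 0"
  then obtain a where "g = [:a:]" by (auto elim: degree_eq_zeroE)
  with assms show False by (simp add: is_min_ipoly_def)
qed

lemma min_ipoly_pseudo_dvd:
  fixes x :: "'a::field_char_0"
  assumes g: "is_min_ipoly g x" and f: "ipoly f x = 0"
  obtains k q where "smult (lead_coeff g ^ k) f = g * q"
proof -
  obtain q r where qr: "pseudo_divmod f g = (q, r)" by force
  from g have g0: "g \<noteq> 0" "ipoly g x = 0" by (auto simp: is_min_ipoly_def)
  from pseudo_divmod[OF g0(1) qr] obtain k
    where k: "smult (lead_coeff g ^ k) f = g * q + r" "r = 0 \<or> degree r < degree g" by blast
  have "ipoly (smult (lead_coeff g ^ k) f) x = 0" by (simp add: f)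
  hence "ipoly r x = 0" unfolding k(1) by (simp add: g0)
  with k(2) g have "r = 0" by (auto dest: is_min_ipolyD)
  with k(1) that show ?thesis by simp
qed

text \<open>
  The Euclidean algorithm with pseudo-division: after reducing \<open>v\<close> modulo \<open>g\<close>, each step
  replaces \<open>v\<close> by the remainder of \<open>g\<close> by \<open>v\<close>, which cannot vanish at \<open>x\<close> since the cofactor
  would be a polynomial of too small degree vanishing at \<open>x\<close>.
\<close>
lemma ex_inverse_mod_min_ipoly:
  fixes x :: "'a::field_char_0"
  assumes g: "is_min_ipoly g x" and v: "ipoly v x \<noteq> 0"
  shows "\<exists>a e. e \<noteq> 0 \<and> ipoly a x * ipoly v x = of_int e"
proof -
  from g have g0: "g \<noteq> 0" "ipoly g x = 0" by (auto simp: is_min_ipoly_def)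
  have *: "\<exists>a e. e \<noteq> 0 \<and> ipoly a x * ipoly v x = of_int e"
    if "ipoly v x \<noteq> 0" "degree v < degree g" for v
    using that
  proof (induction "degree v" arbitrary: v rule: less_induct)
    case less
    show ?case
    proof (cases "degree v = 0")
      case True
      then obtain c where "v = [:c:]" by (auto elim: degree_eq_zeroE)
      with less.prems show ?thesis by (intro exI[of _ 1] exI[of _ c]) auto
    next
      case False
      have v0: "v \<noteq> 0" using less.prems by auto
      obtain q r where qr: "pseudo_divmod g v = (q, r)" by force
      from pseudo_divmod[OF v0 qr] obtain k
        where k: "smult (lead_coeff v ^ k) g = v * q + r" "r = 0 \<or> degree r < degree v" by blast
      have "ipoly (smult (lead_coeff v ^ k) g) x = 0" by (simp add: g0)
      hence r: "ipoly r x = - ipoly q x * ipoly v x" unfolding k(1) by (simp add: eq_neg_iff_add_eq_0 algebra_simps)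
      have "ipoly r x \<noteq> 0"
      proof
        assume r0: "ipoly r x = 0"
        hence "r = 0" using k(2) less.prems(2) g by (auto intro: is_min_ipolyD)
        with k have eq: "smult (lead_coeff v ^ k) g = v * q" by simp
        have "q \<noteq> 0" using eq g0 v0 by auto
        moreover have "ipoly q x = 0" using r r0 less.prems by auto
        moreover have "degree g = degree v + degree q"
        proof -
          have "degree (smult (lead_coeff v ^ k) g) = degree g" using v0 by simp
          thus ?thesis unfolding eq using v0 \<open>q \<noteq> 0\<close> by (simp add: degree_mult_eq)
        qed
        ultimately show False using False g by (auto dest: is_min_ipolyD)
      qed
      with k(2) less.hyps[of r] less.prems obtain a e where "e \<noteq> 0" "ipoly a x * ipoly r x = of_int e"
        by force
      thus ?thesis by (intro exI[of _ "- a * q"] exI[of _ e]) (simp add: r mult_ac)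
    qed
  qed
  obtain q r where qr: "pseudo_divmod v g = (q, r)" by force
  from pseudo_divmod[OF g0(1) qr] obtain k
    where k: "smult (lead_coeff g ^ k) v = g * q + r" "r = 0 \<or> degree r < degree g" by blast
  have r: "of_int (lead_coeff g ^ k) * ipoly v x = ipoly r x"
    using arg_cong[OF k(1), of "\<lambda>p. ipoly p x"] by (simp add: g0)
  have "ipoly r x \<noteq> 0" unfolding r [symmetric] using g0 v by simp
  with k(2) *[of r] obtain a e where "e \<noteq> 0" "ipoly a x * ipoly r x = of_int e" by force
  thus ?thesis
    by (intro exI[of _ "smult (lead_coeff g ^ k) a"] exI[of _ e]) (simp add: r [symmetric] mult_ac)
qed

text \<open>
  The ring \<open>\<rat>[x]\<close>, which is the field \<open>\<rat>(x)\<close> for algebraic \<open>x\<close>. Elements are represented by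
  an integer polynomial and an integer denominator, the form in which they can be reduced modulo
  primes.
\<close>
definition Qadj :: "'a::field_char_0 \<Rightarrow> 'a set" where
  "Qadj x = {y. \<exists>q N. N \<noteq> 0 \<and> of_int N * y = ipoly q x}"

lemma QadjI: "N \<noteq> 0 \<Longrightarrow> of_int N * y = ipoly q x \<Longrightarrow> y \<in> Qadj x"
  by (auto simp: Qadj_def)

lemma QadjE:
  assumes "y \<in> Qadj x" obtains q N where "N \<noteq> 0" "of_int N * y = ipoly q x"
  using assms by (auto simp: Qadj_def)

lemma Qadj_ipoly [simp]: "ipoly q x \<in> Qadj x"
  by (rule QadjI[of 1 _ q]) auto

lemma Qadj_self [simp]: "x \<in> Qadj x"
  using Qadj_ipoly[of "[:0, 1:]" x] by simp

lemma Qadj_of_int [simp]: "of_int a \<in> Qadj x"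
  using Qadj_ipoly[of "[:a:]" x] by simp

lemma Qadj_0 [simp]: "0 \<in> Qadj x" and Qadj_1 [simp]: "1 \<in> Qadj x"
  using Qadj_of_int[of 0 x] Qadj_of_int[of 1 x] by simp_all

lemma Qadj_add [intro]: "y + z \<in> Qadj x" if "y \<in> Qadj x" "z \<in> Qadj x"
proof -
  from that obtain q N r M where "N \<noteq> 0" "of_int N * y = ipoly q x" "M \<noteq> 0" "of_int M * z = ipoly r x"
    by (elim QadjE)
  thus ?thesis
    by (intro QadjI[of "N * M" _ "smult M q + smult N r"]) (auto simp: algebra_simps)
qed

lemma Qadj_mult [intro]: "y * z \<in> Qadj x" if "y \<in> Qadj x" "z \<in> Qadj x"
proof -
  from that obtain q N r M where "N \<noteq> 0" and q: "of_int N * y = ipoly q x" and "M \<noteq> 0" and r: "of_int M * z = ipoly r x"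
    by (elim QadjE)
  thus ?thesis
    by (intro QadjI[of "N * M" _ "q * r"]) (auto simp: mult_ac simp flip: q r)
qed

lemma Qadj_uminus [intro]: "y \<in> Qadj x \<Longrightarrow> - y \<in> Qadj x"
  using Qadj_mult[OF Qadj_of_int[of "-1" x], of y] by simp

lemma Qadj_diff [intro]: "y \<in> Qadj x \<Longrightarrow> z \<in> Qadj x \<Longrightarrow> y - z \<in> Qadj x"
  using Qadj_add[of y x "- z"] by auto

lemma Qadj_sum [intro]: "(\<And>i. i \<in> A \<Longrightarrow> f i \<in> Qadj x) \<Longrightarrow> sum f A \<in> Qadj x"
  by (induction A rule: infinite_finite_induct) auto

lemma Qadj_power [intro]: "y \<in> Qadj x \<Longrightarrow> y ^ n \<in> Qadj x"
  by (induction n) auto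

lemma Qadj_inverse:
  assumes "algebraic x" "y \<in> Qadj x"
  shows "inverse y \<in> Qadj x"
proof (cases "y = 0")
  case False
  obtain g where g: "is_min_ipoly g x" using ex_min_ipoly[OF assms(1)] .
  obtain q N where q: "N \<noteq> 0" "of_int N * y = ipoly q x" using assms(2) by (rule QadjE)
  have "ipoly q x \<noteq> 0" unfolding q(2) [symmetric] using q(1) False by simp
  then obtain a e where a: "e \<noteq> 0" "ipoly a x * ipoly q x = of_int e"
    using ex_inverse_mod_min_ipoly[OF g] by blast
  have "of_int e * inverse y = ipoly (smult N a) x"
    using False by (simp flip: a(2) q(2))
  thus ?thesis by (rule QadjI[OF a(1)])
qed simp

lemma Qadj_divide: "algebraic x \<Longrightarrow> y \<in> Qadj x \<Longrightarrow> z \<in> Qadj x \<Longrightarrow> y / z \<in> Qadj x"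
  unfolding divide_inverse by (intro Qadj_mult Qadj_inverse)

lemma Qadj_poly:
  assumes "\<And>i. coeff p i \<in> Qadj x" "y \<in> Qadj x"
  shows "poly p y \<in> Qadj x"
  unfolding poly_altdef using assms by auto

lemma Qadj_subset:
  assumes "y \<in> Qadj x" "algebraic x"
  shows "Qadj y \<subseteq> Qadj x"
proof
  fix z assume "z \<in> Qadj y"
  then obtain q N where q: "N \<noteq> 0" "of_int N * z = ipoly q y" by (rule QadjE)
  have "ipoly q y \<in> Qadj x"
    unfolding ipoly_def by (rule Qadj_poly) (auto simp: coeff_map_poly assms)
  hence "ipoly q y / of_int N \<in> Qadj x" by (intro Qadj_divide assms) auto
  also have "ipoly q y / of_int N = z" using q by (simp add: field_simps)
  finally show "z \<in> Qadj x" .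
qed

section \<open>Algebraic numbers and primitive elements\<close>

interpretation Q: vector_space "\<lambda>(q::rat) (x::'a::field_char_0). of_rat q * x"
  by unfold_locales (auto simp: algebra_simps of_rat_add of_rat_mult)

text \<open>
  All powers of \<open>x\<close> lie in the finite-dimensional rational vector space spanned by \<open>T\<close>, so they
  are linearly dependent.
\<close>
lemma algebraic_if_stabilises_finite_span:
  fixes x :: "'a::field_char_0"
  assumes T: "finite T" "1 \<in> Q.span T" and stable: "\<And>t. t \<in> T \<Longrightarrow> x * t \<in> Q.span T"
  shows "algebraic x"
proof -
  have mult: "x * y \<in> Q.span T" if "y \<in> Q.span T" for y
    using that
  proof (induction rule: Q.span_induct_alt)
    case (step c t y)
    have "of_rat c * (x * t) + x * y \<in> Q.span T"
      using step stable by (intro Q.span_add Q.span_scale) auto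
    thus ?case by (simp add: algebra_simps)
  qed (simp add: Q.span_zero)
  have pow: "x ^ n \<in> Q.span T" for n
    by (induction n) (auto simp: T mult)
  define S where "S = (\<lambda>n. x ^ n) ` {..card T}"
  show ?thesis
  proof (cases "inj_on (\<lambda>n. x ^ n) {..card T}")
    case True
    hence "card S = Suc (card T)" unfolding S_def by (subst card_image) auto
    hence "Q.dependent S"
      using Q.independent_span_bound[OF T(1), of S] pow unfolding S_def by fastforce
    moreover have "finite S" by (simp add: S_def)
    ultimately obtain u where u: "\<exists>v\<in>S. u v \<noteq> 0" "(\<Sum>v\<in>S. of_rat (u v) * v) = 0"
      using Q.dependent_finite by blast
    define p :: "'a poly" where "p = (\<Sum>n\<le>card T. monom (of_rat (u (x ^ n))) n)"
    have coeff_p: "coeff p i = (if i \<le> card T then of_rat (u (x ^ i)) else 0)" for i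
      by (simp add: p_def coeff_sum if_distrib cong: if_cong) 
    show ?thesis
    proof (rule algebraicI'[of p])
      show "coeff p i \<in> \<rat>" for i by (auto simp: coeff_p)
      from u(1) obtain n where "n \<le> card T" "u (x ^ n) \<noteq> 0" by (auto simp: S_def)
      hence "coeff p n \<noteq> 0" by (simp add: coeff_p)
      thus "p \<noteq> 0" by auto
      have "poly p x = (\<Sum>n\<le>card T. of_rat (u (x ^ n)) * x ^ n)"
        by (simp add: p_def poly_sum poly_monom)
      also have "\<dots> = (\<Sum>v\<in>S. of_rat (u v) * v)"
        unfolding S_def by (subst sum.reindex[OF True]) simp
      finally show "poly p x = 0" using u(2) by simp
    qed
  next
    case False
    then obtain m n where "m < n" "x ^ m = x ^ n"
      unfolding inj_on_def by (metis linorder_neqE_nat)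
    hence "coeff (monom 1 n - monom 1 m :: 'a poly) n \<noteq> 0" "poly (monom 1 n - monom 1 m) x = 0"
      by (auto simp: poly_monom)
    moreover from this(1) have "monom 1 n - monom 1 m \<noteq> (0 :: 'a poly)" by force
    ultimately show ?thesis
      by (intro algebraicI[of "monom 1 n - monom 1 m"]) auto
  qed
qed

lemma algebraic_power_reduction:
  fixes x :: "'a::field_char_0"
  assumes "algebraic x"
  obtains m and c :: "nat \<Rightarrow> rat" where "m > 0" "x ^ m = (\<Sum>i<m. of_rat (c i) * x ^ i)"
proof -
  obtain g where g: "is_min_ipoly g x" using ex_min_ipoly[OF assms] .
  define m where "m = degree g"
  define c :: "nat \<Rightarrow> rat" where "c i = - of_int (coeff g i) / of_int (lead_coeff g)" for i
  have "m > 0" unfolding m_def using min_ipoly_degree_pos[OF g] .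
  have lc: "lead_coeff g \<noteq> 0" using g by (auto simp: is_min_ipoly_def)
  have "0 = ipoly g x" using g by (simp add: is_min_ipoly_def)
  also have "\<dots> = (\<Sum>i\<le>m. of_int (coeff g i) * x ^ i)"
    by (simp add: ipoly_def poly_altdef coeff_map_poly degree_map_poly m_def)
  also have "{..m} = insert m {..<m}" by auto
  also have "(\<Sum>i\<in>\<dots>. of_int (coeff g i) * x ^ i) =
      of_int (lead_coeff g) * x ^ m + (\<Sum>i<m. of_int (coeff g i) * x ^ i)"
    by (subst sum.insert) (auto simp: m_def)
  finally have "x ^ m = - (\<Sum>i<m. of_int (coeff g i) * x ^ i) / of_int (lead_coeff g)"
    using lc by (simp add: field_simps eq_neg_iff_add_eq_0)
  also have "\<dots> = (\<Sum>i<m. of_rat (c i) * x ^ i)"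
    by (simp add: c_def of_rat_divide of_rat_minus sum_divide_distrib sum_negf [symmetric])
  finally show ?thesis using \<open>m > 0\<close> that by blast
qed

text \<open>
  The finitely many products \<open>x\<^sup>i y\<^sup>j\<close> with exponents below the degrees of \<open>x\<close> and \<open>y\<close> span a
  space that is stable under multiplication by \<open>x\<close> and by \<open>y\<close>.
\<close>
lemma algebraic_add_mult:
  fixes x y :: "'a::field_char_0"
  assumes "algebraic x" "algebraic y"
  shows algebraic_add: "algebraic (x + y)" and algebraic_mult: "algebraic (x * y)"
proof -
  obtain m and c :: "nat \<Rightarrow> rat" where m: "m > 0" "x ^ m = (\<Sum>i<m. of_rat (c i) * x ^ i)"
    using algebraic_power_reduction[OF assms(1)] .
  obtain n and d :: "nat \<Rightarrow> rat" where n: "n > 0" "y ^ n = (\<Sum>i<n. of_rat (d i) * y ^ i)"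
    using algebraic_power_reduction[OF assms(2)] .
  define T where "T = (\<lambda>(i, j). x ^ i * y ^ j) ` ({..<m} \<times> {..<n})"
  have T: "finite T" by (simp add: T_def)
  have mem: "x ^ i * y ^ j \<in> T" if "i < m" "j < n" for i j
    using that by (force simp: T_def)
  have one: "1 \<in> Q.span T" using mem[of 0 0] m n by (intro Q.span_base) auto
  have xT: "x * t \<in> Q.span T" if "t \<in> T" for t
  proof -
    from that obtain i j where ij: "i < m" "j < n" "t = x ^ i * y ^ j" by (auto simp: T_def)
    show ?thesis
    proof (cases "Suc i < m")
      case True
      have "x * t = x ^ Suc i * y ^ j" by (simp add: ij mult_ac)
      also have "\<dots> \<in> Q.span T" by (intro Q.span_base mem True ij)
      finally show ?thesis .
    next
      case False
      hence "m = Suc i" using ij by simp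
      hence "x * t = x ^ m * y ^ j" using ij by (simp add: mult_ac)
      also have "\<dots> = (\<Sum>k<m. of_rat (c k) * (x ^ k * y ^ j))"
        unfolding m(2) sum_distrib_right by (rule sum.cong) (simp_all add: mult_ac)
      also have "\<dots> \<in> Q.span T"
        by (rule Q.span_sum, rule Q.span_scale, rule Q.span_base, rule mem) (use ij in auto)
      finally show ?thesis .
    qed
  qed
  have yT: "y * t \<in> Q.span T" if "t \<in> T" for t
  proof -
    from that obtain i j where ij: "i < m" "j < n" "t = x ^ i * y ^ j" by (auto simp: T_def)
    show ?thesis
    proof (cases "Suc j < n")
      case True
      have "y * t = x ^ i * y ^ Suc j" by (simp add: ij mult_ac)
      also have "\<dots> \<in> Q.span T" by (intro Q.span_base mem True ij)
      finally show ?thesis .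
    next
      case False
      hence "n = Suc j" using ij by simp
      hence "y * t = x ^ i * y ^ n" using ij by (simp add: mult_ac)
      also have "\<dots> = (\<Sum>k<n. of_rat (d k) * (x ^ i * y ^ k))"
        unfolding n(2) sum_distrib_left by (rule sum.cong) (simp_all add: mult_ac)
      also have "\<dots> \<in> Q.span T"
        by (rule Q.span_sum, rule Q.span_scale, rule Q.span_base, rule mem) (use ij in auto)
      finally show ?thesis .
    qed
  qed
  have x_span: "x * t \<in> Q.span T" if "t \<in> Q.span T" for t
    using that
  proof (induction rule: Q.span_induct_alt)
    case (step c s t)
    have "of_rat c * (x * s) + x * t \<in> Q.span T"
      using step xT by (intro Q.span_add Q.span_scale) auto
    thus ?case by (simp add: algebra_simps)
  qed (simp add: Q.span_zero)
  show "algebraic (x + y)"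
    by (rule algebraic_if_stabilises_finite_span[OF T one]) (auto simp: distrib_right intro: Q.span_add xT yT)
  show "algebraic (x * y)"
    by (rule algebraic_if_stabilises_finite_span[OF T one]) (auto simp: mult.assoc intro: x_span yT)
qed

lemma algebraic_uminus: "algebraic x \<Longrightarrow> algebraic (- x :: 'a::field_char_0)"
  using algebraic_mult[of "of_int (-1)" x] by simp

lemma algebraic_of_real_iff: "algebraic (of_real x :: 'a::{real_algebra_1,field_char_0}) \<longleftrightarrow> algebraic x"
  by (simp add: algebraic_iff_ipoly ipoly_of_real)

lemma algebraic_Re_Im:
  assumes "algebraic z"
  shows "algebraic (Re z)" "algebraic (Im z)"
proof -
  have cnj: "algebraic (cnj z)"
    using assms by (simp add: algebraic_iff_ipoly ipoly_cnj)
  have half: "algebraic (1 / 2 :: complex)" "algebraic (- \<i> / 2)"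
    using rat_imp_algebraic[of "1 / 2 :: complex"] algebraic_mult[of "- 1 / 2" "\<i>"] rat_imp_algebraic[of "- 1 / 2 :: complex"]
    by auto
  have "complex_of_real (Re z) = 1 / 2 * (z + cnj z)" by (simp add: complex_add_cnj)
  also have "algebraic \<dots>" by (intro algebraic_mult algebraic_add half assms cnj)
  finally show "algebraic (Re z)" by (simp only: algebraic_of_real_iff)
  have "complex_of_real (Im z) = - \<i> / 2 * (z + - cnj z)" by (simp add: complex_eq_iff)
  also have "algebraic \<dots>" by (intro algebraic_mult algebraic_add algebraic_uminus half assms cnj)
  finally show "algebraic (Im z)" by (simp only: algebraic_of_real_iff)
qed

text \<open>
  Polynomial division does not leave the coefficient field.
\<close>
lemma Qadj_poly_div:
  fixes p m :: "'a::field_char_0 poly"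
  assumes x: "algebraic x" and m: "m \<noteq> 0" "\<And>i. coeff m i \<in> Qadj x" and p: "\<And>i. coeff p i \<in> Qadj x"
  shows "\<exists>s r. p = m * s + r \<and> (\<forall>i. coeff r i \<in> Qadj x) \<and> (r = 0 \<or> degree r < degree m)"
  using p
proof (induction "degree p" arbitrary: p rule: less_induct)
  case less
  show ?case
  proof (cases "p = 0 \<or> degree p < degree m")
    case True
    thus ?thesis using less.prems by (intro exI[of _ 0] exI[of _ p]) auto
  next
    case False
    define a where "a = lead_coeff p / lead_coeff m"
    define q where "q = monom a (degree p - degree m)"
    have a: "a \<in> Qadj x" unfolding a_def by (intro Qadj_divide x m less.prems)
    have a0: "a \<noteq> 0" using False m by (simp add: a_def)
    have deg: "degree (m * q) = degree p"
      using False m a0 by (simp add: q_def degree_mult_eq degree_monom_eq monom_eq_0_iff)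
    have lc: "lead_coeff (m * q) = lead_coeff p"
    proof -
      have "lead_coeff q = a" using a0 by (simp add: q_def degree_monom_eq)
      thus ?thesis using m by (simp add: lead_coeff_mult a_def)
    qed
    have coeffs: "coeff (p - m * q) i \<in> Qadj x" for i
      unfolding coeff_diff coeff_mult q_def
      using a m less.prems by (auto intro!: Qadj_diff Qadj_sum Qadj_mult)
    show ?thesis
    proof (cases "p - m * q = 0")
      case True
      thus ?thesis by (intro exI[of _ q] exI[of _ 0]) auto
    next
      case nz: False
      have "degree (p - m * q) \<le> degree p" using deg by (intro degree_diff_le) auto
      moreover have "degree (p - m * q) \<noteq> degree p"
        using nz lc deg by (metis coeff_diff diff_self leading_coeff_0_iff)
      ultimately obtain s r where "p - m * q = m * s + r" "\<forall>i. coeff r i \<in> Qadj x" "r = 0 \<or> degree r < degree m"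
        using less.hyps[of "p - m * q"] coeffs by force
      thus ?thesis by (intro exI[of _ "q + s"] exI[of _ r]) (auto simp: algebra_simps)
    qed
  qed
qed

text \<open>
  Let \<open>f\<close> and \<open>g\<close> be integer polynomials with roots \<open>x\<close> and \<open>y\<close>. For all but finitely many
  \<open>c\<close>, the number \<open>t = x + c y\<close> is different from \<open>x' + c y'\<close> for all
  roots \<open>x'\<close> of \<open>f\<close> and all roots \<open>y' \<noteq> y\<close> of \<open>g\<close>. Then \<open>y\<close> is the only common root of \<open>g\<close>
  and \<open>f (t - c X)\<close>, both of which have coefficients in \<open>\<rat>(t)\<close>. The polynomial \<open>m\<close> of least degree
  over \<open>\<rat>(t)\<close> with root \<open>y\<close> divides both, and \<open>y\<close> is a simple root of it, so it is linear.
\<close>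
lemma primitive_element_two:
  fixes x y :: complex
  assumes x: "algebraic x" and y: "algebraic y"
  shows "\<exists>c::nat. x \<in> Qadj (x + of_nat c * y) \<and> y \<in> Qadj (x + of_nat c * y)"
proof -
  obtain f where f: "f \<noteq> 0" "ipoly f x = 0" using x by (auto simp: algebraic_iff_ipoly)
  obtain g where g: "g \<noteq> 0" "ipoly g y = 0" using y by (auto simp: algebraic_iff_ipoly)
  have fin: "finite {z::complex. ipoly h z = 0}" if "h \<noteq> 0" for h
    unfolding ipoly_def using that by (intro poly_roots_finite) (auto simp: map_poly_eq_0_iff)
  \<comment> \<open>The values of \<open>c\<close> for which \<open>x + c y = x' + c y'\<close> for some roots \<open>x'\<close> and \<open>y' \<noteq> y\<close>; the quotient is 0 for \<open>y' = y\<close>.\<close>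
  define B where "B = (\<lambda>(x', y'). (x' - x) / (y - y')) ` ({z. ipoly f z = 0} \<times> {z. ipoly g z = 0})"
  have "finite B" unfolding B_def using fin f g by auto
  hence "finite {c::nat. of_nat c \<in> B}"
    using finite_vimageI[of B "of_nat :: nat \<Rightarrow> complex"] by (auto simp: vimage_def inj_on_def)
  then obtain c :: nat where c: "of_nat c \<notin> B"
    using infinite_UNIV_nat by (metis (no_types, lifting) UNIV_I finite_subset mem_Collect_eq subsetI)
  define t where "t = x + of_nat c * y"
  have t: "algebraic t" unfolding t_def by (intro algebraic_add algebraic_mult x y) auto
  define P where "P p \<longleftrightarrow> p \<noteq> 0 \<and> (\<forall>i. coeff p i \<in> Qadj t) \<and> poly p y = 0" for p :: "complex poly"
  define G where "G = map_poly (of_int :: int \<Rightarrow> complex) g"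
  define F where "F = pcompose (map_poly (of_int :: int \<Rightarrow> complex) f) [:t, - of_nat c:]"
  have G: "P G" using g by (auto simp: P_def G_def coeff_map_poly map_poly_eq_0_iff ipoly_def)
  obtain m where m: "P m" "\<And>p. P p \<Longrightarrow> degree m \<le> degree p"
    using ex_has_least_nat[of P, OF G, of degree] by blast
  have m0: "m \<noteq> 0" "\<And>i. coeff m i \<in> Qadj t" "poly m y = 0" using m(1) by (auto simp: P_def)
  have dvd: "m dvd p" if p: "\<And>i. coeff p i \<in> Qadj t" "poly p y = 0" for p
  proof -
    obtain s r where r: "p = m * s + r" "\<forall>i. coeff r i \<in> Qadj t" "r = 0 \<or> degree r < degree m"
      using Qadj_poly_div[OF t m0(1,2) p(1)] by blast
    have "poly r y = 0" using p(2) m0(3) unfolding r(1) by simp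
    hence "r = 0" using r m(2)[of r] unfolding P_def by force
    with r show ?thesis by simp
  qed
  have mG: "m dvd G" using G by (intro dvd) (auto simp: P_def)
  have mF: "m dvd F"
  proof (rule dvd)
    show "poly F y = 0" using f by (simp add: F_def poly_pcompose t_def ipoly_def algebra_simps)
    have "coeff F i \<in> Qadj t" if "\<And>i. coeff q i \<in> Qadj t" "F = pcompose q [:t, - of_nat c:]" for q F i
      using that
    proof (induction q arbitrary: F i)
      case (pCons a q)
      have "coeff q i \<in> Qadj t" for i using pCons.prems(1)[of "Suc i"] by simp
      define r where "r = pcompose q [:t, - of_nat c:]"
      have IH: "coeff r i \<in> Qadj t" for i
        by (rule pCons.IH[OF \<open>\<And>i. coeff q i \<in> Qadj t\<close> r_def])
      have a: "a \<in> Qadj t" using pCons.prems(1)[of 0] by simp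
      have nat: "of_nat c \<in> Qadj t" using Qadj_of_int[of "int c" t] by simp
      show ?case unfolding pCons.prems(2) pcompose_pCons r_def [symmetric]
        using IH a nat by (cases i) (auto simp: coeff_pCons intro!: Qadj_add Qadj_mult Qadj_uminus)
    qed simp
    thus "coeff F i \<in> Qadj t" for i unfolding F_def by (rule) (auto simp: coeff_map_poly)
  qed
  have roots: "z = y" if "poly m z = 0" for z
  proof (rule ccontr)
    assume "z \<noteq> y"
    have "poly G z = 0" "poly F z = 0" using mG mF that by (auto elim!: dvdE)
    hence "ipoly g z = 0" "ipoly f (t - of_nat c * z) = 0"
      by (simp_all add: G_def F_def ipoly_def poly_pcompose mult.commute)
    hence "(t - of_nat c * z - x) / (y - z) \<in> B" unfolding B_def by force
    moreover have "(t - of_nat c * z - x) / (y - z) = of_nat c"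
      using \<open>z \<noteq> y\<close> by (simp add: t_def field_simps)
    ultimately show False using c by simp
  qed
  have deg_m: "degree m > 0"
    using m0 by (metis degree_eq_zeroE gr0I pCons_0_0 poly_const_conv)
  have simple: "poly (pderiv m) y \<noteq> 0"
  proof
    assume "poly (pderiv m) y = 0"
    moreover have "pderiv m \<noteq> 0" using deg_m by (auto simp: pderiv_eq_0_iff)
    moreover have "coeff (pderiv m) i \<in> Qadj t" for i
      unfolding coeff_pderiv using m0(2) Qadj_of_int[of "int (Suc i)" t] by (intro Qadj_mult) (auto simp del: of_nat_Suc)
    ultimately have "degree m \<le> degree (pderiv m)" by (intro m(2)) (auto simp: P_def)
    thus False using deg_m by (simp add: degree_pderiv)
  qed
  obtain s where s: "m = [:- y, 1:] * s" using m0(3) by (auto simp: poly_eq_0_iff_dvd elim: dvdE)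
  have "poly s y \<noteq> 0"
    using simple unfolding s pderiv_mult poly_add poly_mult by (simp add: pderiv_pCons)
  hence "poly s z \<noteq> 0" for z
    using roots[of z] unfolding s by auto
  hence "degree s = 0"
    using fundamental_theorem_of_algebra_alt[of s] by (metis degree_pCons_0 poly_0 degree_0)
  then obtain a where a: "s = [:a:]" by (auto elim: degree_eq_zeroE)
  have "a \<noteq> 0" using m0(1) by (auto simp: s a)
  have "coeff m 0 = - y * a" "coeff m 1 = a" by (simp_all add: s a)
  hence "y = - (coeff m 0 / coeff m 1)" using \<open>a \<noteq> 0\<close> by simp
  also have "\<dots> \<in> Qadj t" by (intro Qadj_uminus Qadj_divide t m0(2))
  finally have y_mem: "y \<in> Qadj t" .
  have "x = t - of_nat c * y" by (simp add: t_def)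
  also have "\<dots> \<in> Qadj t" using Qadj_of_int[of "int c" t] y_mem by (intro Qadj_diff Qadj_mult) auto
  finally show ?thesis using y_mem unfolding t_def by blast
qed

lemma Qadj_of_real_iff: "complex_of_real y \<in> Qadj (complex_of_real x) \<longleftrightarrow> y \<in> Qadj x"
proof -
  have "of_int N * complex_of_real y = ipoly q (complex_of_real x) \<longleftrightarrow> of_int N * y = ipoly q x" for N q
    unfolding ipoly_of_real by (metis of_real_eq_iff of_real_mult of_real_of_int_eq)
  thus ?thesis by (simp add: Qadj_def)
qed

lemma primitive_element_real:
  fixes A :: "real set"
  assumes "finite A" "\<And>x. x \<in> A \<Longrightarrow> algebraic x"
  shows "\<exists>t. algebraic t \<and> A \<subseteq> Qadj t"
  using assms
proof (induction rule: finite_induct)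
  case (insert x A)
  then obtain s where s: "algebraic s" "A \<subseteq> Qadj s" by auto
  have x: "algebraic x" using insert.prems by simp
  obtain c :: nat where c: "complex_of_real x \<in> Qadj (of_real x + of_nat c * of_real s)"
      "complex_of_real s \<in> Qadj (of_real x + of_nat c * of_real s)"
    using primitive_element_two[of "of_real x" "of_real s"] x s by (auto simp: algebraic_of_real_iff)
  define t where "t = x + of_nat c * s"
  have t: "algebraic t" unfolding t_def by (intro algebraic_add algebraic_mult x s) auto
  have "of_real x + of_nat c * of_real s = complex_of_real t" by (simp add: t_def)
  with c have "x \<in> Qadj t" "s \<in> Qadj t" by (simp_all add: Qadj_of_real_iff)
  with s t Qadj_subset[of s t] show ?case by blast
qed (auto intro: exI[of _ 0])

section \<open>Primes congruent to 3 modulo 4 that divide values of a polynomial\<close>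

text \<open>
  Otherwise \<open>-1\<close> would be a square modulo \<open>p\<close>; raising \<open>u\<^sup>2 \<equiv> - v\<^sup>2\<close> to the odd power
  \<open>(p - 1) / 2\<close> contradicts Fermat's theorem.
\<close>
lemma prime_3_mod_4_dvd_sum_squares:
  fixes p u v :: int
  assumes p: "prime p" "p mod 4 = 3" and dvd: "p dvd u\<^sup>2 + v\<^sup>2"
  shows "p dvd v"
proof (rule ccontr)
  assume nv: "\<not> p dvd v"
  have nu: "\<not> p dvd u"
  proof
    assume "p dvd u"
    hence "p dvd v\<^sup>2" using dvd by (simp add: power2_eq_square dvd_add_right_iff)
    with nv p show False by (simp add: prime_dvd_power_iff)
  qed
  have p0: "p > 0" using p(1) by (rule prime_gt_0_int)
  then obtain q where q: "p = int q" by (metis zero_less_imp_eq_int)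
  have q4: "q mod 4 = 3" using p(2) unfolding q by presburger
  define n where "n = (q - 1) div 2"
  have n: "q - 1 = 2 * n" "odd n"
    using q4 unfolding n_def by presburger+
  have fermat: "[w ^ (2 * n) = 1] (mod p)" if "\<not> p dvd w" for w :: int
  proof -
    have "[nat \<bar>w\<bar> ^ (q - 1) = 1] (mod q)"
      using that p unfolding q by (intro fermat_theorem) auto
    hence "[int (nat \<bar>w\<bar> ^ (2 * n)) = int 1] (mod int q)"
      unfolding n(1) cong_int_iff .
    thus ?thesis by (simp add: q power_even_abs)
  qed
  have "[u\<^sup>2 = - (v\<^sup>2)] (mod p)"
    using dvd by (simp add: cong_iff_dvd_diff)
  hence "[(u\<^sup>2) ^ n = (- (v\<^sup>2)) ^ n] (mod p)" by (rule cong_pow)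
  also have "(- (v\<^sup>2)) ^ n = - (v ^ (2 * n))" using n(2) by (simp add: power_minus_odd power_mult)
  finally have "[u ^ (2 * n) = - (v ^ (2 * n))] (mod p)" by (simp add: power_mult)
  moreover have "[- (v ^ (2 * n)) = - 1] (mod p)"
    using fermat[OF nv] by (simp add: cong_minus_minus_iff)
  moreover have "[1 = u ^ (2 * n)] (mod p)"
    using fermat[OF nu] by (simp add: cong_sym_eq)
  ultimately have "[1 = - 1] (mod p)" by (blast intro: cong_trans)
  hence "p dvd 2" by (simp add: cong_iff_dvd_diff)
  hence "p \<le> 2" by (rule zdvd_imp_le) simp
  moreover have "p \<noteq> 2" "p \<noteq> 1" "p \<noteq> 0" using p(2) by auto
  ultimately show False using p0 by linarith
qed

text \<open>
  A product of odd numbers with none congruent to 3 modulo 4 is congruent to 1 modulo 4.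
\<close>
lemma ex_prime_factor_3_mod_4:
  fixes n :: int
  assumes "n > 0" "n mod 4 = 3"
  shows "\<exists>p. prime p \<and> p mod 4 = 3 \<and> p dvd n"
  using assms
proof (induction "nat n" arbitrary: n rule: less_induct)
  case less
  have "n \<noteq> 1" using less.prems by auto
  then obtain p where p: "prime p" "p dvd n"
    using less.prems prime_factor_int[of n] by auto
  have p1: "p > 1" using p(1) by (rule prime_gt_1_int)
  obtain k where k: "n = p * k" using p(2) by auto
  show ?case
  proof (cases "p mod 4 = 3")
    case False
    have eq: "((p mod 4) * (k mod 4)) mod 4 = 3"
      using less.prems unfolding k by (simp add: mod_mult_eq)
    have "p mod 4 \<in> {0, 1, 2, 3}" "k mod 4 \<in> {0, 1, 2, 3}" by auto
    with eq False have k4: "k mod 4 = 3" by auto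
    have "k > 0" using less.prems(1) p1 unfolding k by (simp add: zero_less_mult_iff)
    moreover have "k < n" using p1 \<open>k > 0\<close> unfolding k by simp
    ultimately obtain q where "prime q" "q mod 4 = 3" "q dvd k"
      using less.hyps[of k] k4 less.prems by auto
    thus ?thesis unfolding k by auto
  qed (use p in auto)
qed

lemma pderiv_map_poly_of_int:
  "pderiv (map_poly of_int g) = (map_poly of_int (pderiv g) :: 'a::{idom,ring_char_0} poly)"
  by (rule poly_eqI) (simp add: coeff_pderiv coeff_map_poly)

lemma min_ipoly_simple_root:
  fixes x :: "'a::field_char_0"
  assumes "is_min_ipoly g x"
  shows "ipoly (pderiv g) x \<noteq> 0"
proof
  assume "ipoly (pderiv g) x = 0"
  moreover have "degree (pderiv g) < degree g"
    using min_ipoly_degree_pos[OF assms] by (simp add: degree_pderiv)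
  ultimately have "pderiv g = 0" using assms by (auto dest: is_min_ipolyD)
  with min_ipoly_degree_pos[OF assms] show False by (simp add: pderiv_eq_0_iff)
qed

lemma ex_interval_neg:
  fixes f :: "real \<Rightarrow> real"
  assumes "(f has_real_derivative D) (at x)" "D \<noteq> 0" "f x = 0"
  obtains l r where "l < r" "\<And>t. l < t \<Longrightarrow> t < r \<Longrightarrow> f t < 0"
proof (cases "D > 0")
  case True
  from DERIV_pos_inc_left[OF assms(1) True] obtain d where
    d: "d > 0" "\<And>h. h > 0 \<Longrightarrow> h < d \<Longrightarrow> f (x - h) < f x" by blast
  show ?thesis
  proof (rule that[of "x - d" x])
    show "f t < 0" if "x - d < t" "t < x" for t
      using d(2)[of "x - t"] that assms(3) by simp
  qed (use d in simp)
next
  case False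
  hence "D < 0" using assms(2) by simp
  from DERIV_neg_dec_right[OF assms(1) this] obtain d where
    d: "d > 0" "\<And>h. h > 0 \<Longrightarrow> h < d \<Longrightarrow> f (x + h) < f x" by blast
  show ?thesis
  proof (rule that[of x "x + d"])
    show "f t < 0" if "x < t" "t < x + d" for t
      using d(2)[of "t - x"] that assms(3) by simp
  qed (use d in simp)
qed

text \<open>
  Near a simple real root, \<open>c * g\<close> is negative on some interval, where \<open>c\<close> is the leading
  coefficient. In it there is a rational number \<open>X / y\<close> with \<open>X \<equiv> 1\<close> modulo a suitable \<open>K\<close> and
  \<open>y\<close> a power of \<open>K\<close>. The value \<open>h\<close> of the homogenisation of \<open>g\<close> at \<open>(X, y)\<close> is then \<open>c w\<close>
  with \<open>w\<close> negative and congruent to 1 modulo 4 and modulo every small prime. So \<open>- w\<close> is positive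
  and congruent to 3 modulo 4, and has a prime factor of the required kind.
\<close>
lemma ex_prime_3_mod_4_with_root:
  fixes g :: "int poly" and x :: real and B :: int
  assumes root: "ipoly g x = 0" "ipoly (pderiv g) x \<noteq> 0"
  shows "\<exists>p a. prime p \<and> p > B \<and> p mod 4 = 3 \<and> p dvd poly g a"
proof -
  define c where "c = lead_coeff g"
  define n where "n = degree g"
  define F :: int where "F = fact (nat \<bar>B\<bar>)"
  \<comment> \<open>The factor 4 controls \<open>w\<close> modulo 4, and \<open>F\<close> keeps all primes up to \<open>B\<close> away from \<open>w\<close>. One factor \<open>c\<close>
    is cancelled when passing from \<open>h\<close> to \<open>w\<close>, the other one makes \<open>p\<close> coprime to \<open>c\<close>, hence to \<open>y\<close>.\<close>
  define K where "K = 4 * F * c\<^sup>2"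
  have "g \<noteq> 0" using root by auto
  hence c0: "c \<noteq> 0" by (simp add: c_def)
  have F: "F > 0" by (simp add: F_def)
  have K: "K \<ge> 4"
  proof -
    have "F * c\<^sup>2 \<ge> 1" using F c0 by (simp add: int_one_le_iff_zero_less)
    thus ?thesis by (simp add: K_def)
  qed
  have "((\<lambda>t. of_int c * ipoly g t) has_real_derivative of_int c * ipoly (pderiv g) x) (at x)"
    unfolding ipoly_def pderiv_map_poly_of_int [symmetric] by (intro DERIV_cmult poly_DERIV)
  then obtain l r where lr: "l < r" "\<And>t. l < t \<Longrightarrow> t < r \<Longrightarrow> real_of_int c * ipoly g t < 0"
    by (rule ex_interval_neg) (use root c0 in auto)
  obtain k where k: "of_int K / (r - l) < real_of_int K ^ k"
    using real_arch_pow[of "real_of_int K"] K by force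
  define y where "y = K ^ Suc k"
  have y: "y > 0" "K dvd y" using K by (auto simp: y_def)
  have long: "real_of_int y * (r - l) > K"
  proof -
    have "real_of_int K < real_of_int K ^ k * (r - l)"
      using k lr(1) by (simp add: field_simps)
    also have "\<dots> \<le> real_of_int K * (real_of_int K ^ k * (r - l))"
      using K lr(1) mult_right_mono[of 1 "real_of_int K" "real_of_int K ^ k * (r - l)"] by simp
    finally show ?thesis by (simp add: y_def mult_ac)
  qed
  \<comment> \<open>The interval from \<open>l y\<close> to \<open>r y\<close> is longer than \<open>K\<close>, so it meets the residue class of 1 modulo \<open>K\<close>.\<close>
  define z where "z = \<lfloor>(l * y - 1) / K\<rfloor> + 1"
  define X where "X = 1 + K * z"
  have "(l * y - 1) / K < z" "z \<le> (l * y - 1) / K + 1"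
    unfolding z_def by linarith+
  hence "l * y < real_of_int X" "real_of_int X \<le> l * y + K"
    using K by (simp_all add: X_def field_simps)
  hence Xy: "l < X / y" "X / y < r"
    using long y(1) by (simp_all add: field_simps)
  define h where "h = (\<Sum>i\<le>n. coeff g i * X ^ i * y ^ (n - i))"
  have h_eq: "real_of_int h = real_of_int y ^ n * ipoly g (X / y)"
  proof -
    have "ipoly g (X / y) = (\<Sum>i\<le>n. real_of_int (coeff g i) * (X / y) ^ i)"
      by (simp add: ipoly_def poly_altdef degree_map_poly coeff_map_poly n_def)
    moreover have term_eq: "real_of_int y ^ n * (real_of_int (coeff g i) * (X / y) ^ i) =
        real_of_int (coeff g i * X ^ i * y ^ (n - i))" if "i \<le> n" for i
    proof -
      have "real_of_int y ^ n = real_of_int y ^ i * real_of_int y ^ (n - i)"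
        using that by (simp add: power_add [symmetric])
      thus ?thesis using y(1) by (simp add: power_divide)
    qed
    ultimately show ?thesis
      by (simp only: h_def of_int_sum sum_distrib_left) (rule sum.cong[OF refl], subst term_eq, auto)
  qed
  have "real_of_int (c * h) = real_of_int y ^ n * (real_of_int c * ipoly g (X / y))"
    by (simp add: h_eq)
  also have "\<dots> < 0"
    by (rule mult_pos_neg[OF _ lr(2)[OF Xy]]) (use y(1) in simp)
  finally have ch: "c * h < 0" by (simp only: of_int_less_0_iff)
  have "K dvd h - c * X ^ n"
  proof -
    have "{..n} = insert n {..<n}" by auto
    hence "h - c * X ^ n = (\<Sum>i<n. coeff g i * X ^ i * y ^ (n - i))"
      by (simp add: h_def c_def n_def)
    moreover have "K dvd coeff g i * X ^ i * y ^ (n - i)" if "i < n" for i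
      using that y(2) by (intro dvd_mult) (metis dvd_power dvd_trans zero_less_diff)
    ultimately show ?thesis by (auto intro: dvd_sum)
  qed
  then obtain s where "h - c * X ^ n = K * s" by (rule dvdE)
  hence s: "h = c * X ^ n + K * s" by simp
  define w where "w = X ^ n + 4 * F * c * s"
  have hw: "h = c * w" unfolding s w_def K_def by (simp add: power2_eq_square algebra_simps)
  have "c * h = c\<^sup>2 * w" by (simp add: hw power2_eq_square)
  with ch c0 have w0: "w < 0" by (simp add: mult_less_0_iff)
  have w1: "4 * F * c dvd w - 1"
  proof -
    have "[X = 1] (mod K)" by (simp add: X_def cong_iff_dvd_diff)
    hence "[X ^ n = 1 ^ n] (mod K)" by (rule cong_pow)
    hence "K dvd X ^ n - 1" by (simp add: cong_iff_dvd_diff)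
    hence "4 * F * c dvd X ^ n - 1"
      unfolding K_def power2_eq_square by (metis dvd_mult_left mult.assoc)
    hence "4 * F * c dvd (X ^ n - 1) + 4 * F * c * s" by (intro dvd_add) auto
    thus ?thesis by (simp add: w_def algebra_simps)
  qed
  have "(- w) mod 4 = 3"
  proof -
    have "4 dvd w - 1" using w1 by (meson dvd_mult_left dvd_trans)
    thus ?thesis by presburger
  qed
  then obtain p where p: "prime p" "p mod 4 = 3" "p dvd - w"
    using ex_prime_factor_3_mod_4[of "- w"] w0 by auto
  have pw: "p dvd w" using p(3) by simp
  have ndvd: "\<not> p dvd 4 * F * c"
  proof
    assume "p dvd 4 * F * c"
    hence "p dvd w - 1" using w1 by (rule dvd_trans)
    from dvd_diff[OF pw this] have "p dvd 1" by simp
    with p(1) show False using not_prime_unit by blast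
  qed
  have "p > B"
  proof (rule ccontr)
    assume "\<not> p > B"
    hence "nat p dvd fact (nat \<bar>B\<bar>)"
      using prime_gt_1_int[OF p(1)] by (intro dvd_fact) auto
    hence "int (nat p) dvd int (fact (nat \<bar>B\<bar>))" by (simp only: int_dvd_int_iff)
    hence "p dvd F" using prime_gt_1_int[OF p(1)] by (simp add: F_def)
    with ndvd show False by auto
  qed
  have "\<not> p dvd K"
    using ndvd p(1) by (auto simp: K_def prime_dvd_mult_iff power2_eq_square)
  hence "\<not> p dvd y"
    unfolding y_def using p(1) prime_dvd_power by blast
  hence cop: "coprime y p" using p(1) by (simp add: prime_imp_coprime coprime_commute)
  then obtain y' where y': "[y * y' = 1] (mod p)" using cong_solve_coprime_int by blast
  have "[y ^ n * poly g (X * y') = h] (mod p)"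
  proof -
    have "y ^ n * poly g (X * y') = (\<Sum>i\<le>n. coeff g i * X ^ i * y ^ (n - i) * (y * y') ^ i)"
      unfolding poly_altdef sum_distrib_left n_def [symmetric]
    proof (rule sum.cong[OF refl])
      fix i assume "i \<in> {..n}"
      hence "y ^ n = y ^ i * y ^ (n - i)" by (simp add: power_add [symmetric])
      thus "y ^ n * (coeff g i * (X * y') ^ i) = coeff g i * X ^ i * y ^ (n - i) * (y * y') ^ i"
        by (simp add: power_mult_distrib mult_ac)
    qed
    also have "[\<dots> = (\<Sum>i\<le>n. coeff g i * X ^ i * y ^ (n - i) * 1 ^ i)] (mod p)"
      by (intro cong_sum cong_mult cong_pow y' cong_refl)
    finally show ?thesis by (simp add: h_def)
  qed
  moreover have "p dvd h" using pw by (simp add: hw)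
  ultimately have "p dvd y ^ n * poly g (X * y')" by (simp add: cong_dvd_iff)
  hence "p dvd poly g (X * y')"
    using p(1) \<open>\<not> p dvd y\<close> by (auto simp: prime_dvd_mult_iff dest: prime_dvd_power)
  with p \<open>p > B\<close> show ?thesis by blast
qed

section \<open>Primes modulo which a polynomial has no root\<close>

text \<open>
  Let \<open>t\<close> generate a real field containing the real and imaginary parts of all complex roots
  \<open>z\<close>, let \<open>p \<equiv> 3 (mod 4)\<close> be large and let \<open>b\<close> be a root modulo \<open>p\<close> of the minimal polynomial of
  \<open>t\<close>. Relations between integer polynomials at \<open>t\<close> become congruences at \<open>b\<close>. One such
  relation is \<open>F(x)\<^sup>2 = c\<^sup>2 \<Prod> ((x - Re z)\<^sup>2 + (Im z)\<^sup>2)\<close>. If \<open>p\<close> divides \<open>F x\<close>, it therefore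
  divides one of the sums of two squares, and with it the image of \<open>Im z\<close>. But \<open>Im z\<close> is
  invertible, and this relation is preserved, too.
\<close>
theorem ex_prime_without_root:
  fixes F :: "int poly" and B :: int
  assumes no_root: "\<And>x::real. ipoly F x \<noteq> 0"
  shows "\<exists>p. prime p \<and> p > B \<and> (\<forall>x::int. \<not> p dvd poly F x)"
proof -
  define c where "c = lead_coeff F"
  define G where "G = map_poly (of_int :: int \<Rightarrow> complex) F"
  define R where "R = {z. poly G z = 0}"
  define k where "k z = order z G" for z
  have "F \<noteq> 0" using no_root by auto
  hence c0: "c \<noteq> 0" and G0: "G \<noteq> 0" by (auto simp: c_def G_def map_poly_eq_0_iff)
  have finR: "finite R" unfolding R_def using G0 by (rule poly_roots_finite)
  have R: "ipoly F z = 0" if "z \<in> R" for z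
    using that by (simp add: R_def G_def ipoly_def)
  have alg: "algebraic z" if "z \<in> R" for z
    using R[OF that] \<open>F \<noteq> 0\<close> by (auto simp: algebraic_iff_ipoly)
  have Im_nz: "Im z \<noteq> 0" if "z \<in> R" for z
  proof
    assume "Im z = 0"
    hence "z = of_real (Re z)" by (simp add: complex_eq_iff)
    hence "ipoly F (complex_of_real (Re z)) = 0" using R[OF that] by simp
    with no_root[of "Re z"] show False by (simp add: ipoly_of_real)
  qed
  have "algebraic x" if "x \<in> Re ` R \<union> Im ` R" for x
    using that alg algebraic_Re_Im by blast
  then obtain t where t: "algebraic t" "Re ` R \<union> Im ` R \<subseteq> Qadj t"
    using primitive_element_real[of "Re ` R \<union> Im ` R"] finR by blast
  obtain g where g: "is_min_ipoly g t" using ex_min_ipoly[OF t(1)] .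
  have "\<exists>N U V a e. N \<noteq> 0 \<and> of_int N * Re z = ipoly U t \<and> of_int N * Im z = ipoly V t \<and>
      e \<noteq> 0 \<and> ipoly a t * ipoly V t = of_int e" if "z \<in> R" for z
  proof -
    from t(2) that have "Re z \<in> Qadj t" "Im z \<in> Qadj t" by auto
    then obtain N U M V where *: "N \<noteq> 0" "of_int N * Re z = ipoly U t" "M \<noteq> 0" "of_int M * Im z = ipoly V t"
      by (elim QadjE)
    have "ipoly (smult N V) t \<noteq> 0"
      using * Im_nz[OF that] by (simp flip: *(4))
    from ex_inverse_mod_min_ipoly[OF g this] obtain a e where
      "e \<noteq> 0" "ipoly a t * ipoly (smult N V) t = of_int e" by blast
    moreover have "of_int (N * M) * Re z = ipoly (smult M U) t" "of_int (N * M) * Im z = ipoly (smult N V) t"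
      by (simp_all flip: *(2,4))
    ultimately show ?thesis using *(1,3) by (metis mult_eq_0_iff)
  qed
  then obtain N U V a e where NUV: "\<And>z. z \<in> R \<Longrightarrow> N z \<noteq> 0"
      "\<And>z. z \<in> R \<Longrightarrow> of_int (N z) * Re z = ipoly (U z) t" "\<And>z. z \<in> R \<Longrightarrow> of_int (N z) * Im z = ipoly (V z) t"
      "\<And>z. z \<in> R \<Longrightarrow> e z \<noteq> 0" "\<And>z. z \<in> R \<Longrightarrow> ipoly (a z) t * ipoly (V z) t = of_int (e z)"
    by metis
  \<comment> \<open>A prime above this bound exceeds \<open>B\<close> and divides neither \<open>c\<close> nor the leading coefficient of \<open>g\<close>
    nor any \<open>e z\<close>.\<close>
  define B' where "B' = \<bar>B\<bar> + \<bar>c\<bar> + \<bar>lead_coeff g\<bar> + (\<Sum>z\<in>R. \<bar>e z\<bar>)"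
  have e_le: "\<bar>e z\<bar> \<le> (\<Sum>z\<in>R. \<bar>e z\<bar>)" if "z \<in> R" for z
    using finR that by (intro member_le_sum) auto
  have g0: "lead_coeff g \<noteq> 0" "ipoly g t = 0" using g by (auto simp: is_min_ipoly_def)
  obtain p b where p: "prime p" "p > B'" "p mod 4 = 3" "p dvd poly g b"
    using ex_prime_3_mod_4_with_root[OF g0(2) min_ipoly_simple_root[OF g]] by blast
  have e_sum: "(\<Sum>z\<in>R. \<bar>e z\<bar>) \<ge> 0" by (intro sum_nonneg) auto
  have small: "\<not> p dvd i" if "i \<noteq> 0" "\<bar>i\<bar> \<le> B'" for i
    using that p(2) dvd_imp_le_int[of i p] by auto
  have "\<bar>c\<bar> \<le> B'" "\<bar>lead_coeff g\<bar> \<le> B'" "B \<le> B'"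
    using e_sum unfolding B'_def by linarith+
  hence "\<not> p dvd c" "\<not> p dvd lead_coeff g" "p > B"
    using small[OF c0] small[OF g0(1)] p(2) by auto
  have "\<not> p dvd e z" if "z \<in> R" for z
    using NUV(4)[OF that] e_le[OF that] by (intro small) (auto simp: B'_def)
  have reduce: "p dvd poly W b" if W: "ipoly W t = 0" for W
  proof -
    obtain i q where "smult (lead_coeff g ^ i) W = g * q"
      using min_ipoly_pseudo_dvd[OF g W] .
    hence "lead_coeff g ^ i * poly W b = poly g b * poly q b"
      by (metis poly_mult poly_smult)
    with p(4) have "p dvd lead_coeff g ^ i * poly W b" by simp
    with p(1) \<open>\<not> p dvd lead_coeff g\<close> show ?thesis
      by (auto simp: prime_dvd_mult_iff dest: prime_dvd_power)
  qed
  have "\<not> p dvd poly F x" for x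
  proof
    assume dvd: "p dvd poly F x"
    \<comment> \<open>Clearing the denominators \<open>N z\<close> in the product formula for \<open>F(x)\<^sup>2\<close> gives integer polynomials in \<open>t\<close>.\<close>
    define H where "H = (\<Prod>z\<in>R. (([:N z * x:] - U z)\<^sup>2 + (V z)\<^sup>2) ^ k z)"
    define M where "M = (\<Prod>z\<in>R. (N z)\<^sup>2 ^ k z)"
    have "(of_int (poly F x) :: complex) = poly G (of_int x)"
      using ipoly_of_int[of F x, where ?'a = complex] by (simp add: ipoly_def G_def)
    also have "\<dots> = of_int c * (\<Prod>z\<in>R. (of_int x - z) ^ k z)"
      by (subst complex_poly_decompose [symmetric])
         (simp add: poly_prod R_def k_def c_def G_def coeff_map_poly degree_map_poly)
    finally have "(cmod (of_int (poly F x)))\<^sup>2 = (cmod (of_int c * (\<Prod>z\<in>R. (of_int x - z) ^ k z)))\<^sup>2"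
      by simp
    hence "(real_of_int (poly F x))\<^sup>2 = (of_int c)\<^sup>2 * (\<Prod>z\<in>R. ((cmod (of_int x - z))\<^sup>2) ^ k z)"
      by (simp add: norm_mult power_mult_distrib prod_norm [symmetric] norm_power prod_power_distrib
        power_mult [symmetric] mult.commute)
    hence "of_int M * (real_of_int (poly F x))\<^sup>2 =
        (of_int c)\<^sup>2 * (\<Prod>z\<in>R. ((of_int (N z))\<^sup>2 * (cmod (of_int x - z))\<^sup>2) ^ k z)"
      by (simp add: M_def prod.distrib power_mult_distrib)
    also have "(\<Prod>z\<in>R. ((of_int (N z))\<^sup>2 * (cmod (of_int x - z))\<^sup>2) ^ k z) = ipoly H t"
      unfolding H_def ipoly_prod ipoly_power
    proof (rule prod.cong[OF refl], rule arg_cong[of _ _ "\<lambda>x. x ^ _"])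
      fix z assume z: "z \<in> R"
      have "(of_int (N z))\<^sup>2 * (cmod (of_int x - z))\<^sup>2 =
          (of_int (N z) * of_int x - of_int (N z) * Re z)\<^sup>2 + (of_int (N z) * Im z)\<^sup>2"
        unfolding cmod_power2 by (simp add: power2_eq_square algebra_simps)
      also have "\<dots> = ipoly (([:N z * x:] - U z)\<^sup>2 + (V z)\<^sup>2) t"
        unfolding NUV(2,3)[OF z] by simp
      finally show "(of_int (N z))\<^sup>2 * (cmod (of_int x - z))\<^sup>2 = ipoly (([:N z * x:] - U z)\<^sup>2 + (V z)\<^sup>2) t" .
    qed
    finally have "ipoly (smult (c\<^sup>2) H - [:M * (poly F x)\<^sup>2:]) t = 0" by simp
    hence "p dvd poly (smult (c\<^sup>2) H - [:M * (poly F x)\<^sup>2:]) b" by (rule reduce)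
    hence "p dvd c\<^sup>2 * poly H b - M * (poly F x)\<^sup>2" by simp
    moreover have "p dvd M * (poly F x)\<^sup>2" using dvd by (simp add: power2_eq_square)
    ultimately have "p dvd c\<^sup>2 * poly H b" by (simp add: dvd_diff_left_iff)
    hence "p dvd poly H b"
      using p(1) \<open>\<not> p dvd c\<close> by (auto simp: prime_dvd_mult_iff dest: prime_dvd_power)
    hence "p dvd (\<Prod>z\<in>R. ((N z * x - poly (U z) b)\<^sup>2 + (poly (V z) b)\<^sup>2) ^ k z)"
      by (simp add: H_def poly_prod)
    then obtain z where z: "z \<in> R" "p dvd ((N z * x - poly (U z) b)\<^sup>2 + (poly (V z) b)\<^sup>2) ^ k z"
      using p(1) finR by (auto simp: prime_dvd_prod_iff)
    hence "p dvd poly (V z) b"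
      using p by (intro prime_3_mod_4_dvd_sum_squares[of p _ "poly (V z) b"]) (auto dest: prime_dvd_power)
    moreover have "p dvd poly (a z * V z - [:e z:]) b"
      by (rule reduce) (simp add: NUV(5)[OF z(1)])
    ultimately have "p dvd e z" by (simp add: dvd_diff_right_iff)
    with \<open>\<And>z. z \<in> R \<Longrightarrow> \<not> p dvd e z\<close> z(1) show False by blast
  qed
  with p(1) \<open>p > B\<close> show ?thesis by blast
qed

section \<open>Polynomials with rational coefficients\<close>

lemma even_degree_poly_bounded_below:
  fixes p :: "real poly"
  assumes "even (degree p)" "lead_coeff p > 0"
  shows "\<exists>B. \<forall>x. B \<le> poly p x"
proof -
  obtain n where n: "\<And>x. x \<ge> n \<Longrightarrow> poly p x \<ge> lead_coeff p"
    using poly_pinfty_gt_lc[OF assms(2)] by blast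
  define q where "q = pcompose p [:0, -1:]"
  have q: "poly q x = poly p (- x)" for x by (simp add: q_def poly_pcompose)
  have "lead_coeff q = lead_coeff p"
    unfolding q_def by (subst lead_coeff_comp) (use assms in auto)
  then obtain m where m: "\<And>x. x \<ge> m \<Longrightarrow> poly q x \<ge> lead_coeff p"
    using poly_pinfty_gt_lc[of q] assms by force
  have "compact (poly p ` {-m..n})"
    by (intro compact_continuous_image continuous_intros) auto
  hence "bdd_below (poly p ` {-m..n})"
    by (intro bounded_imp_bdd_below compact_imp_bounded)
  then obtain C where C: "\<And>x. x \<in> {-m..n} \<Longrightarrow> C \<le> poly p x"
    unfolding bdd_below_def by blast
  have "min C (lead_coeff p) \<le> poly p x" for x
  proof (cases "x \<in> {-m..n}")
    case False
    thus ?thesis using n[of x] m[of "- x"] q[of "- x"] by fastforce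
  qed (use C in \<open>auto simp: min_le_iff_disj\<close>)
  thus ?thesis by blast
qed

text \<open>
  The values tend to the same infinity at both ends.
\<close>
lemma even_degree_poly_bounded:
  fixes p :: "real poly"
  assumes "even (degree p)"
  shows "(\<exists>B. \<forall>x. B \<le> poly p x) \<or> (\<exists>B. \<forall>x. poly p x \<le> B)"
proof (cases "lead_coeff p" "0 :: real" rule: linorder_cases)
  case greater
  thus ?thesis using even_degree_poly_bounded_below[of p] assms by blast
next
  case less
  then obtain B where "\<And>x. B \<le> - poly p x"
    using even_degree_poly_bounded_below[of "- p"] assms by auto
  hence "\<forall>x. poly p x \<le> - B" by (simp add: le_minus_iff)
  thus ?thesis by blast
qed auto

text \<open>
  The integer polynomial \<open>R\<close> is \<open>d P\<close> with the fractional part \<open>\<rho>\<close> of its constant term removed,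
  so that \<open>R x - d \<lfloor>P x\<rfloor>\<close> is one of \<open>0, \<dots>, d - 1\<close> for every integer \<open>x\<close>. The residue class
  of \<open>t\<close> is missed modulo every prime modulo which the product \<open>F\<close> of the polynomials
  \<open>R - d t - r\<close> with \<open>0 \<le> r < d\<close> has no root.
\<close>
theorem not_complete_mod_if_rational:
  fixes P :: "real poly" and p0 :: int
  assumes deg: "even (degree P)" and rat: "\<And>i. i \<ge> 1 \<Longrightarrow> coeff P i \<in> \<rat>"
  shows "\<exists>p\<ge>p0. prime p \<and> \<not> complete_mod P p"
proof -
  obtain d :: nat where d: "d > 0" "\<And>i. i \<in> {1..degree P} \<Longrightarrow> of_nat d * coeff P i \<in> \<int>"
    using common_denominator[of "{1..degree P}" "coeff P"] rat by auto
  define R where "R = map_poly floor (smult (real d) P)"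
  define \<rho> where "\<rho> = frac (real d * coeff P 0)"
  have coeff_R: "coeff R i = \<lfloor>real d * coeff P i\<rfloor>" for i
    by (simp add: R_def coeff_map_poly)
  have int: "real d * coeff P i \<in> \<int>" if "i \<ge> 1" for i
    using d(2)[of i] that by (cases "i \<le> degree P") (auto simp: coeff_eq_0)
  have "smult (real d) P = map_poly of_int R + [:\<rho>:]"
  proof (rule poly_eqI)
    fix i show "coeff (smult (real d) P) i = coeff (map_poly of_int R + [:\<rho>:]) i"
      using int[of i] by (cases i) (auto simp: coeff_map_poly coeff_R \<rho>_def frac_def elim: Ints_cases)
  qed
  hence dP: "real d * poly P x = ipoly R x + \<rho>" for x
    unfolding ipoly_def by (metis poly_add poly_smult poly_const_conv)
  have \<rho>: "0 \<le> \<rho>" "\<rho> < 1" by (simp_all add: \<rho>_def frac_lt_1)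
  have "\<exists>t::int. \<forall>(r::int) x. 0 \<le> r \<longrightarrow> r < int d \<longrightarrow> ipoly R (x::real) \<noteq> of_int (int d * t + r)"
    using even_degree_poly_bounded[OF deg]
  proof
    assume "\<exists>B. \<forall>x. B \<le> poly P x"
    then obtain B where B: "\<And>x. B \<le> poly P x" by blast
    have "ipoly R x > of_int (int d * (\<lfloor>B\<rfloor> - 2) + r)" if "r < d" for r :: int and x :: real
    proof -
      have "real_of_int r \<le> real d" using that by linarith
      hence "real_of_int (int d * (\<lfloor>B\<rfloor> - 2) + r) \<le> real d * (real_of_int \<lfloor>B\<rfloor> - 1)"
        by (simp add: algebra_simps)
      also have "\<dots> \<le> real d * (B - 1)" by (intro mult_left_mono) auto
      also have "\<dots> \<le> real d * B - 1" using d(1) by (simp add: algebra_simps)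
      also have "\<dots> \<le> real d * poly P x - 1" using B by (simp add: mult_left_mono)
      also have "\<dots> < ipoly R x" using dP \<rho> by simp
      finally show ?thesis .
    qed
    thus ?thesis by (intro exI[of _ "\<lfloor>B\<rfloor> - 2"]) (metis less_irrefl)
  next
    assume "\<exists>B. \<forall>x. poly P x \<le> B"
    then obtain B where B: "\<And>x. poly P x \<le> B" by blast
    have "ipoly R x < of_int (int d * (\<lfloor>B\<rfloor> + 1) + r)" if "r \<ge> 0" for r :: int and x :: real
    proof -
      have "ipoly R x \<le> real d * poly P x" using dP \<rho> by simp
      also have "\<dots> \<le> real d * B" using B by (simp add: mult_left_mono)
      also have "\<dots> < real d * (\<lfloor>B\<rfloor> + 1)"
        using d(1) by (intro mult_strict_left_mono) (linarith, simp)
      also have "\<dots> \<le> of_int (int d * (\<lfloor>B\<rfloor> + 1) + r)" using that by simp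
      finally show ?thesis .
    qed
    thus ?thesis by (intro exI[of _ "\<lfloor>B\<rfloor> + 1"]) (metis less_irrefl)
  qed
  then obtain t :: int where t: "\<And>(r::int) x. 0 \<le> r \<Longrightarrow> r < int d \<Longrightarrow> ipoly R (x::real) \<noteq> of_int (int d * t + r)"
    by blast
  define F where "F = (\<Prod>r\<in>{0..<int d}. R - [:int d * t + r:])"
  have "ipoly F (x::real) \<noteq> 0" for x
    using t by (auto simp: F_def)
  then obtain p where p: "prime p" "p > p0" "\<And>x. \<not> p dvd poly F x"
    using ex_prime_without_root[of F p0] by blast
  have "\<not> complete_mod P p"
  proof
    assume "complete_mod P p"
    then obtain x :: int where x: "[\<lfloor>poly P (of_int x)\<rfloor> = t] (mod p)"
      unfolding complete_mod_def by blast
    define k where "k = \<lfloor>poly P (of_int x)\<rfloor>"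
    have "real d * k \<le> real d * poly P (of_int x)" "real d * poly P (of_int x) < real d * (k + 1)"
      unfolding k_def using d(1) by (intro mult_left_mono mult_strict_left_mono; linarith)+
    hence "real_of_int (int d * k) < real_of_int (poly R x + 1)" "real_of_int (poly R x) < real_of_int (int d * k + int d)"
      unfolding dP using \<rho> by (simp_all add: algebra_simps)
    hence r: "poly R x - int d * k \<in> {0..<int d}" by (simp only: of_int_less_iff) auto
    have "poly (R - [:int d * t + (poly R x - int d * k):]) x dvd poly F x"
      unfolding F_def poly_prod by (rule dvd_prodI[OF _ r]) simp
    moreover have "poly (R - [:int d * t + (poly R x - int d * k):]) x = int d * (k - t)"
      by (simp add: algebra_simps)
    moreover have "p dvd int d * (k - t)"
      using x by (simp add: k_def cong_iff_dvd_diff)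
    ultimately show False using p(3) dvd_trans by metis
  qed
  with p show ?thesis by (intro exI[of _ p]) auto
qed

section \<open>The equivalence\<close>

lemma complete_mod_if_ud_mod:
  assumes "ud_mod (\<lambda>k. \<lfloor>poly P (real k)\<rfloor>) m" "m > 0"
  shows "complete_mod P m"
  unfolding complete_mod_def
proof (rule allI, rule ccontr)
  fix n :: int
  assume "\<nexists>x. [\<lfloor>poly P (real_of_int x)\<rfloor> = n] (mod m)"
  hence "\<not> [\<lfloor>poly P (real k)\<rfloor> = n] (mod m)" for k
    by (metis of_int_of_nat_eq)
  with assms(1) have "(\<lambda>N::nat. 0 :: real) \<longlonglongrightarrow> 1 / m"
    unfolding ud_mod_def by (auto dest: spec[of _ n])
  from LIMSEQ_unique[OF this tendsto_const] assms(2) show False by simp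
qed

theorem theorem7:
  fixes P :: "real poly"
  assumes "even (degree P)"
  shows "((\<exists>p0::int. \<forall>p\<ge>p0. prime p \<longrightarrow> complete_mod P p) \<longleftrightarrow>
            (\<exists>i\<ge>1. coeff P i \<notin> \<rat>))
       \<and> ((\<exists>i\<ge>1. coeff P i \<notin> \<rat>) \<longleftrightarrow>
            ud_in_Z (\<lambda>k. \<lfloor>poly P (of_nat k)\<rfloor>))
       \<and> (ud_in_Z (\<lambda>k. \<lfloor>poly P (of_nat k)\<rfloor>) \<longleftrightarrow>
            (\<forall>m::int. m \<ge> 2 \<longrightarrow> complete_mod P m))"
proof -
  have "\<exists>i\<ge>1. coeff P i \<notin> \<rat>" if "\<exists>p0::int. \<forall>p\<ge>p0. prime p \<longrightarrow> complete_mod P p"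
    using that not_complete_mod_if_rational[OF assms] by blast
  moreover have "ud_in_Z (\<lambda>k. \<lfloor>poly P (of_nat k)\<rfloor>)" if "\<exists>i\<ge>1. coeff P i \<notin> \<rat>"
    using that by (rule ud_in_Z_floor_poly)
  moreover have "\<forall>m::int. m \<ge> 2 \<longrightarrow> complete_mod P m" if "ud_in_Z (\<lambda>k. \<lfloor>poly P (of_nat k)\<rfloor>)"
    using that by (auto simp: ud_in_Z_def intro: complete_mod_if_ud_mod)
  moreover have "\<exists>p0::int. \<forall>p\<ge>p0. prime p \<longrightarrow> complete_mod P p"
    if "\<forall>m::int. m \<ge> 2 \<longrightarrow> complete_mod P m"
    using that by blast
  ultimately show ?thesis by argo
qed

end
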